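(* Suppose $\Omega\subset\mathbb{C}^d$ is a $\mathbb{C}$-properly convex domain and every domain in $\overline{\mathrm{Aff}(\mathbb{C}^d)\cdot\Omega}\cap\mathbb{X}_d$ has simple boundary. Assume $\sigma_n:[a_n,b_n]\to\Omega$ is a sequence of geodesics in $(\Omega,K_\Omega)$ such that $$\lim_{n\to\infty}\sigma_n(a_n)=\xi\in\overline{\Omega}^{\mathrm{End}}\quad\text{and}\quad\lim_{n\to\infty}\sigma_n(b_n)=\eta\in\overline{\Omega}^{\mathrm{End}}.$$ If $\xi\ne\eta$, then there exist sequences $n_j\to\infty$ and $T_j\in[a_{n_j},b_{n_j}]$ such that $\sigma_{n_j}(T_j)$ converges to a point in $\Omega$.
   Context: A convex domain in $\mathbb{C}^d$ is $\mathbb{C}$-properly convex if it contains no entire complex affine line; on such a domain the Kobayashi pseudo-distance $K_\Omega$ is a genuine distance. A geodesic in $(\Omega,K_\Omega)$ is a map $\sigma:I\to\Omega$ from an interval with $K_\Omega(\sigma(s),\sigma(t))=|s-t|$ for all $s,t\in I$. $\overline{\Omega}^{\mathrm{End}}$ denotes the (Freudenthal) end compactification of the Euclidean closure $\overline{\Omega}$. $\mathbb{X}_d$ is the set of all non-empty $\mathbb{C}$-properly convex domains in $\mathbb{C}^d$, with the local Hausdorff topology: $\Omega_n\to\Omega$ in $\mathbb{X}_d$ if there is $R_0\ge0$ such that for all $R\ge R_0$ the Hausdorff distance between $\overline{\Omega}_n\cap\overline{B(0;R)}$ and $\overline{\Omega}\cap\overline{B(0;R)}$ tends to $0$, where $B(0;R)$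 is the Euclidean ball (the Hausdorff distance between the empty set and a non-empty set is $\infty$). $\mathrm{Aff}(\mathbb{C}^d)$ is the group of complex affine automorphisms of $\mathbb{C}^d$; $\overline{\mathrm{Aff}(\mathbb{C}^d)\cdot\Omega}\cap\mathbb{X}_d$ is the set of all $\mathcal{D}\in\mathbb{X}_d$ for which there are $A_n\in\mathrm{Aff}(\mathbb{C}^d)$ with $A_n\Omega\to\mathcal{D}$ in $\mathbb{X}_d$. A domain has simple boundary if every holomorphic map from the unit disk $\mathbb{D}\subset\mathbb{C}$ into its boundary is constant. *)

theory Defs
  imports "HOL-Complex_Analysis.Complex_Analysis" "HOL-Library.FuncSet"
begin

definition holomorphic_disc_into :: "(complex \<Rightarrow> complex ^ 'd) \<Rightarrow> (complex ^ 'd) set \<Rightarrow> bool"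
  where "holomorphic_disc_into f S \<longleftrightarrow>
    (\<forall>i. (\<lambda>z. f z $ i) holomorphic_on ball 0 1) \<and> f ` ball 0 1 \<subseteq> S"

(* Normalised to have curvature -4 (Kobayashi metric |v| at the origin).  Another
   normalisation would only rescale the parameters of geodesics. *)
definition poincare_dist :: "complex \<Rightarrow> complex \<Rightarrow> real"
  where "poincare_dist z w = artanh (cmod ((z - w) / (1 - cnj w * z)))"

(* Total lengths of the chains of holomorphic discs from x to y.  The chain consists of the
   n + 1 discs f 0, ..., f n with marked points s k, t k. *)
definition disc_chain_lengths :: "(complex ^ 'd) set \<Rightarrow> complex ^ 'd \<Rightarrow> complex ^ 'd \<Rightarrow> real set"
  where "disc_chain_lengths \<Omega> x y =
    {(\<Sum>k\<le>n. poincare_dist (s k) (t k)) | (n :: nat) f s t.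
       (\<forall>k\<le>n. holomorphic_disc_into (f k) \<Omega> \<and> s k \<in> ball 0 1 \<and> t k \<in> ball 0 1) \<and>
       f 0 (s 0) = x \<and> f n (t n) = y \<and> (\<forall>k<n. f k (t k) = f (Suc k) (s (Suc k)))}"

(* For x, y in a domain the set of lengths is non-empty and bounded below by 0. *)
definition kobayashi_dist :: "(complex ^ 'd) set \<Rightarrow> complex ^ 'd \<Rightarrow> complex ^ 'd \<Rightarrow> real"
  where "kobayashi_dist \<Omega> x y = Inf (disc_chain_lengths \<Omega> x y)"

definition kobayashi_geodesic :: "(complex ^ 'd) set \<Rightarrow> real set \<Rightarrow> (real \<Rightarrow> complex ^ 'd) \<Rightarrow> bool"
  where "kobayashi_geodesic \<Omega> I \<sigma> \<longleftrightarrow> is_interval I \<and> \<sigma> ` I \<subseteq> \<Omega> \<and>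
    (\<forall>s\<in>I. \<forall>t\<in>I. kobayashi_dist \<Omega> (\<sigma> s) (\<sigma> t) = \<bar>s - t\<bar>)"

definition C_properly_convex_domain :: "(complex ^ 'd) set \<Rightarrow> bool"
  where "C_properly_convex_domain \<Omega> \<longleftrightarrow> \<Omega> \<noteq> {} \<and> open \<Omega> \<and> convex \<Omega> \<and>
    \<not> (\<exists>p v. v \<noteq> 0 \<and> range (\<lambda>c :: complex. p + c *s v) \<subseteq> \<Omega>)"

definition complex_affine_automorphisms :: "(complex ^ 'd \<Rightarrow> complex ^ 'd) set"
  where "complex_affine_automorphisms =
    {\<lambda>z. M *v z + b | (M :: complex ^ 'd ^ 'd) b. invertible M}"

(* Extended-valued: infinite if exactly one of the sets is empty, 0 if both are. *)
definition hausdorff_edist :: "'a::metric_space set \<Rightarrow> 'a set \<Rightarrow> ennreal"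
  where "hausdorff_edist A B =
    max (SUP x\<in>A. INF y\<in>B. ennreal (dist x y)) (SUP y\<in>B. INF x\<in>A. ennreal (dist x y))"

definition local_hausdorff_tendsto :: "(nat \<Rightarrow> (complex ^ 'd) set) \<Rightarrow> (complex ^ 'd) set \<Rightarrow> bool"
  where "local_hausdorff_tendsto D E \<longleftrightarrow> (\<exists>R0\<ge>0. \<forall>R\<ge>R0.
    (\<lambda>n. hausdorff_edist (closure (D n) \<inter> closure (ball 0 R)) (closure E \<inter> closure (ball 0 R)))
      \<longlonglongrightarrow> 0)"

definition affine_orbit_closure :: "(complex ^ 'd) set \<Rightarrow> (complex ^ 'd) set set"
  where "affine_orbit_closure \<Omega> = {D. C_properly_convex_domain D \<and>
    (\<exists>A. (\<forall>n. A n \<in> complex_affine_automorphisms) \<and> local_hausdorff_tendsto (\<lambda>n. A n ` \<Omega>) D)}"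

definition simple_boundary :: "(complex ^ 'd) set \<Rightarrow> bool"
  where "simple_boundary \<Omega> \<longleftrightarrow>
    (\<forall>f. holomorphic_disc_into f (frontier \<Omega>) \<longrightarrow> f constant_on ball 0 1)"

(* An end of X is an element of the inverse limit, over the compact subsets K of X, of the
   sets of connected components of X - K.  Extensionality makes ends equal when they
   agree on all compact subsets of X. *)
definition ends :: "'a::topological_space set \<Rightarrow> ('a set \<Rightarrow> 'a set) set"
  where "ends X = {e \<in> (\<Pi>\<^sub>E K\<in>{K. compact K \<and> K \<subseteq> X}. components (X - K)).
    \<forall>K L. compact K \<and> K \<subseteq> L \<and> compact L \<and> L \<subseteq> X \<longrightarrow> e L \<subseteq> e K}"

datatype 'a end_completion = Point 'a | End "'a set \<Rightarrow> 'a set"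

definition end_open :: "'a::topological_space set \<Rightarrow> 'a end_completion set \<Rightarrow> bool"
  where "end_open X U \<longleftrightarrow> U \<subseteq> Point ` X \<union> End ` ends X \<and>
    openin (top_of_set X) {x. Point x \<in> U} \<and>
    (\<forall>e. End e \<in> U \<longrightarrow> (\<exists>K. compact K \<and> K \<subseteq> X \<and>
       Point ` e K \<subseteq> U \<and> End ` {e' \<in> ends X. e' K = e K} \<subseteq> U))"

(* Freudenthal's compactification when X is Hausdorff, connected, locally connected,
   locally compact and sigma-compact, e.g. a closed convex set in Euclidean space. *)
definition end_compactification :: "'a::topological_space set \<Rightarrow> 'a end_completion topology"
  where "end_compactification X = topology (end_open X)"

lemma end_open_Int:
  assumes "end_open X U" "end_open X V"
  shows "end_open X (U \<inter> V)"
  unfolding end_open_def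
proof (intro conjI allI impI)
  show "U \<inter> V \<subseteq> Point ` X \<union> End ` ends X"
    using assms unfolding end_open_def by blast
  have "openin (top_of_set X) ({x. Point x \<in> U} \<inter> {x. Point x \<in> V})"
    using assms by (intro openin_Int) (simp_all add: end_open_def)
  then show "openin (top_of_set X) {x. Point x \<in> U \<inter> V}"
    by (simp add: Collect_conj_eq)
next
  fix e assume e: "End e \<in> U \<inter> V"
  obtain K where K: "compact K" "K \<subseteq> X" "Point ` e K \<subseteq> U" "End ` {e' \<in> ends X. e' K = e K} \<subseteq> U"
    using assms(1) e unfolding end_open_def by blast
  obtain L where L: "compact L" "L \<subseteq> X" "Point ` e L \<subseteq> V" "End ` {e' \<in> ends X. e' L = e L} \<subseteq> V"
    using assms(2) e unfolding end_open_def by blast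
  let ?M = "K \<union> L"
  have M: "compact ?M" "?M \<subseteq> X" using K L by auto
  have eX: "e \<in> ends X" using assms(1) e unfolding end_open_def by blast
  have sub: "f ?M \<subseteq> f K" "f ?M \<subseteq> f L" if "f \<in> ends X" for f
  proof -
    have mono: "\<And>N N'. compact N \<and> N \<subseteq> N' \<and> compact N' \<and> N' \<subseteq> X \<Longrightarrow> f N' \<subseteq> f N"
      using that unfolding ends_def by blast
    show "f ?M \<subseteq> f K" "f ?M \<subseteq> f L"
      using mono[of K ?M] mono[of L ?M] K(1,2) L(1,2) M by simp_all
  qed
  have comp: "f N \<in> components (X - N)" if "f \<in> ends X" "compact N" "N \<subseteq> X" for f N
    using that unfolding ends_def PiE_iff by blast
  have agree: "f K = e K" "f L = e L" if f: "f \<in> ends X" and eq: "f ?M = e ?M" for f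
  proof -
    have "e ?M \<noteq> {}" using comp[OF eX M] in_components_nonempty by blast
    then have "f K \<inter> e K \<noteq> {}" "f L \<inter> e L \<noteq> {}"
      using sub[OF f] sub[OF eX] eq by auto
    then show "f K = e K" "f L = e L"
      using components_nonoverlap[OF comp[OF f K(1,2)] comp[OF eX K(1,2)]]
        components_nonoverlap[OF comp[OF f L(1,2)] comp[OF eX L(1,2)]] by simp_all
  qed
  have "Point ` e ?M \<subseteq> U \<inter> V" using sub[OF eX] K(3) L(3) by blast
  moreover have "End ` {e' \<in> ends X. e' ?M = e ?M} \<subseteq> U \<inter> V"
  proof (intro image_subsetI)
    fix f assume "f \<in> {e' \<in> ends X. e' ?M = e ?M}"
    then have f: "f \<in> ends X" "f ?M = e ?M" by simp_all
    have "End f \<in> U" using K(4) f(1) agree(1)[OF f] by auto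
    moreover have "End f \<in> V" using L(4) f(1) agree(2)[OF f] by auto
    ultimately show "End f \<in> U \<inter> V" by simp
  qed
  ultimately show "\<exists>K. compact K \<and> K \<subseteq> X \<and> Point ` e K \<subseteq> U \<inter> V \<and>
      End ` {e' \<in> ends X. e' K = e K} \<subseteq> U \<inter> V"
    using M by (intro exI[of _ ?M] conjI)
qed

lemma end_open_Union:
  assumes "\<And>U. U \<in> \<U> \<Longrightarrow> end_open X U"
  shows "end_open X (\<Union>\<U>)"
  unfolding end_open_def
proof (intro conjI allI impI)
  have "U \<subseteq> Point ` X \<union> End ` ends X" if "U \<in> \<U>" for U
    using assms[OF that] unfolding end_open_def by (rule conjunct1)
  then show "\<Union>\<U> \<subseteq> Point ` X \<union> End ` ends X"
    by (rule Union_least)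
  have "openin (top_of_set X) {x. Point x \<in> U}" if "U \<in> \<U>" for U
    using assms[OF that] unfolding end_open_def by (elim conjE)
  then have "openin (top_of_set X) (\<Union>U\<in>\<U>. {x. Point x \<in> U})"
    by (intro openin_Union) (erule imageE, simp)
  moreover have "(\<Union>U\<in>\<U>. {x. Point x \<in> U}) = {x. Point x \<in> \<Union>\<U>}" by blast
  ultimately show "openin (top_of_set X) {x. Point x \<in> \<Union>\<U>}" by simp
next
  fix e assume "End e \<in> \<Union>\<U>"
  then obtain U where U: "U \<in> \<U>" "End e \<in> U" by blast
  have "\<exists>K. compact K \<and> K \<subseteq> X \<and> Point ` e K \<subseteq> U \<and> End ` {e' \<in> ends X. e' K = e K} \<subseteq> U"
    using assms[OF U(1)] U(2) by (simp add: end_open_def)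
  then obtain K where K: "compact K" "K \<subseteq> X" "Point ` e K \<subseteq> U"
      "End ` {e' \<in> ends X. e' K = e K} \<subseteq> U"
    by (elim exE conjE)
  have "U \<subseteq> \<Union>\<U>" using U(1) by (rule Union_upper)
  then show "\<exists>K. compact K \<and> K \<subseteq> X \<and> Point ` e K \<subseteq> \<Union>\<U> \<and>
      End ` {e' \<in> ends X. e' K = e K} \<subseteq> \<Union>\<U>"
    by (intro exI[of _ K] conjI K(1,2) subset_trans[OF K(3)] subset_trans[OF K(4)])
qed

lemma openin_end_compactification: "openin (end_compactification X) U \<longleftrightarrow> end_open X U"
proof -
  have "istopology (end_open X)"
    unfolding istopology_def using end_open_Int end_open_Union by blast
  then show ?thesis
    unfolding end_compactification_def by simp
qed

lemma topspace_end_compactification: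
  "topspace (end_compactification X) = Point ` X \<union> End ` ends X"
proof
  show "topspace (end_compactification X) \<subseteq> Point ` X \<union> End ` ends X"
    unfolding topspace_def openin_end_compactification end_open_def by blast
  have "end_open X (Point ` X \<union> End ` ends X)"
    unfolding end_open_def
  proof (intro conjI allI impI)
    have "{x. Point x \<in> Point ` X \<union> End ` ends X} = X" by auto
    then show "openin (top_of_set X) {x. Point x \<in> Point ` X \<union> End ` ends X}" by simp
  next
    fix e assume "End e \<in> Point ` X \<union> End ` ends X"
    then have "e \<in> ends X" by auto
    then have "\<And>K. compact K \<and> K \<subseteq> X \<Longrightarrow> e K \<in> components (X - K)"
      unfolding ends_def PiE_iff by blast
    from this[of "{}"] have "e {} \<subseteq> X" using in_components_subset by fastforce
    then show "\<exists>K. compact K \<and> K \<subseteq> X \<and> Point ` e K \<subseteq> Point ` X \<union> End ` ends X \<and>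
        End ` {e' \<in> ends X. e' K = e K} \<subseteq> Point ` X \<union> End ` ends X"
      by (intro exI[of _ "{}"]) auto
  qed simp
  then show "Point ` X \<union> End ` ends X \<subseteq> topspace (end_compactification X)"
    unfolding openin_end_compactification[symmetric] by (rule openin_subset)
qed

end

theory Submission
  imports Defs
begin

text \<open>For \<open>x \<in> \<Omega>\<close> let \<open>S\<^sub>x\<close> be the set of vectors \<open>v\<close> such that the affine disc with centre \<open>x\<close> and
  radius vector \<open>v\<close> lies in the closure of \<open>\<Omega>\<close>, and let \<open>\<delta>(x)\<close> be the distance from \<open>x\<close> to the
  complement of \<open>\<Omega>\<close>. Fix \<open>o \<in> \<Omega>\<close>, and for a boundary point \<open>q\<close> put \<open>y\<^sub>s = q + s (o - q)\<close>.

  The simple boundary hypothesis enters through a doubling property: on bounded sets there is \<open>N\<close>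
  such that \<open>v \<in> S\<close> at \<open>y\<^sub>s\<close> implies \<open>2v \<in> S\<close> at \<open>y\<close> with parameter \<open>N s\<close>. If this failed for every
  \<open>N\<close>, then normalising \<open>\<Omega>\<close> affinely at the upper points and passing to a limit would give a domain
  in the closure of the affine orbit whose boundary contains a disc centred at the limit of the
  boundary points \<open>q\<close>. Iterating the doubling property yields
  \<open>\<bar>v\<bar> \<le> C \<delta>(x) powr \<epsilon>\<close> for \<open>v \<in> S\<^sub>x\<close>.

  Supporting hyperplanes and the Schwarz--Pick lemma show that points at Kobayashi distance at
  most 1 differ by at most a constant multiple of a vector of \<open>S\<^sub>x\<close>, and chains of discs bound the
  Kobayashi distance above by multiples of \<open>ln (1 / \<delta>)\<close>. Hence a geodesic in a bounded set
  along which \<open>\<delta> \<le> h\<close> has endpoints at Euclidean distance at most \<open>C h powr \<epsilon>\<close>. If the geodesics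
  left every compact subset of \<open>\<Omega>\<close>, then \<open>h\<close> would tend to 0 on pieces of them of a fixed Euclidean
  size, which exist because \<open>\<xi> \<noteq> \<eta>\<close>.\<close>

section \<open>Gauges of convex sets and local Hausdorff convergence\<close>

definition minkowski_functional :: "'a::real_normed_vector set \<Rightarrow> 'a \<Rightarrow> real"
  where "minkowski_functional W x = Inf {t. 0 < t \<and> (1 / t) *\<^sub>R x \<in> W}"

definition bounded_gauge :: "real \<Rightarrow> ('a::real_normed_vector \<Rightarrow> real) \<Rightarrow> bool"
  where "bounded_gauge C p \<longleftrightarrow> (\<forall>x y. p (x + y) \<le> p x + p y) \<and>
    (\<forall>a x. 0 \<le> a \<longrightarrow> p (a *\<^sub>R x) = a * p x) \<and> (\<forall>x. 0 \<le> p x \<and> p x \<le> C * norm x)"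

lemma bounded_gaugeD:
  assumes "bounded_gauge C p"
  shows bounded_gauge_add: "p (x + y) \<le> p x + p y"
    and bounded_gauge_scale: "0 \<le> a \<Longrightarrow> p (a *\<^sub>R x) = a * p x"
    and bounded_gauge_nonneg: "0 \<le> p x"
    and bounded_gauge_bound: "p x \<le> C * norm x"
  using assms unfolding bounded_gauge_def by blast+

lemma bounded_gauge_diff:
  assumes "bounded_gauge C p"
  shows "\<bar>p x - p y\<bar> \<le> C * norm (x - y)"
proof -
  have "p x \<le> p y + p (x - y)" "p y \<le> p x + p (y - x)"
    using bounded_gauge_add[OF assms, of y "x - y"] bounded_gauge_add[OF assms, of x "y - x"]
    by simp_all
  moreover have "p (x - y) \<le> C * norm (x - y)" "p (y - x) \<le> C * norm (x - y)"
    using bounded_gauge_bound[OF assms, of "x - y"] bounded_gauge_bound[OF assms, of "y - x"]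
    by (simp_all add: norm_minus_commute)
  ultimately show ?thesis by linarith
qed

lemma bounded_gauge_continuous:
  assumes "bounded_gauge C p"
  shows "continuous_on A p"
proof -
  have "(p \<longlongrightarrow> p x) (at x within A)" for x
  proof (rule Lim_null_comparison[THEN LIM_zero_cancel])
    show "\<forall>\<^sub>F y in at x within A. norm (p y - p x) \<le> C * norm (y - x)"
      using bounded_gauge_diff[OF assms] by (intro always_eventually) simp
    have "((\<lambda>y. C * norm (y - x)) \<longlongrightarrow> C * norm (x - x)) (at x within A)"
      by (intro tendsto_intros)
    then show "((\<lambda>y. C * norm (y - x)) \<longlongrightarrow> 0) (at x within A)" by simp
  qed
  then show ?thesis unfolding continuous_on_def by blast
qed

lemma bounded_gauge_open:
  assumes "bounded_gauge C p"
  shows "open {x. p x < 1}"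
  by (intro open_Collect_less bounded_gauge_continuous[OF assms] continuous_on_const)

lemma bounded_gauge_convex:
  assumes "bounded_gauge C p"
  shows "convex {x. p x < 1}"
proof (rule convexI, clarsimp)
  fix x y and u v :: real
  assume *: "p x < 1" "p y < 1" "0 \<le> u" "0 \<le> v" "u + v = 1"
  have "p (u *\<^sub>R x + v *\<^sub>R y) \<le> u * p x + v * p y"
    using bounded_gauge_add[OF assms, of "u *\<^sub>R x" "v *\<^sub>R y"] bounded_gauge_scale[OF assms] * by simp
  also have "\<dots> < 1" by (rule convex_bound_lt) (use * in auto)
  finally show "p (u *\<^sub>R x + v *\<^sub>R y) < 1" .
qed

lemma bounded_gauge_closure:
  assumes "bounded_gauge C p"
  shows "closure {x. p x < 1} = {x. p x \<le> 1}"
proof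
  have "closed {x. p x \<le> 1}"
    by (intro closed_Collect_le bounded_gauge_continuous[OF assms] continuous_on_const)
  then show "closure {x. p x < 1} \<subseteq> {x. p x \<le> 1}"
    by (intro closure_minimal) auto
  show "{x. p x \<le> 1} \<subseteq> closure {x. p x < 1}"
  proof
    fix x assume x: "x \<in> {x. p x \<le> 1}"
    have "(1 - inverse (real (Suc n))) *\<^sub>R x \<in> {x. p x < 1}" for n
    proof -
      have u: "0 < inverse (real (Suc n))" "inverse (real (Suc n)) \<le> 1" by (auto simp: field_simps)
      have "(1 - inverse (real (Suc n))) * p x \<le> (1 - inverse (real (Suc n))) * 1"
        using x u by (intro mult_left_mono) auto
      also have "\<dots> < 1" using u by simp
      finally show ?thesis using bounded_gauge_scale[OF assms, of "1 - inverse (real (Suc n))" x] u by simp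
    qed
    moreover have "(\<lambda>n. (1 - inverse (real (Suc n))) *\<^sub>R x) \<longlonglongrightarrow> (1 - 0) *\<^sub>R x"
      by (intro tendsto_intros LIMSEQ_inverse_real_of_nat)
    ultimately show "x \<in> closure {x. p x < 1}"
      unfolding closure_sequential by (intro exI[of _ "\<lambda>n. (1 - inverse (real (Suc n))) *\<^sub>R x"]) simp
  qed
qed

context
  fixes W :: "'a::real_normed_vector set" and \<rho> :: real
  assumes W: "convex W" "ball 0 \<rho> \<subseteq> W" "0 < \<rho>"
begin

lemma minkowski_functional_le:
  assumes "0 < t" "(1 / t) *\<^sub>R x \<in> W"
  shows "minkowski_functional W x \<le> t"
  unfolding minkowski_functional_def
  by (rule cInf_lower) (use assms in \<open>auto intro!: bdd_belowI[of _ 0]\<close>)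

lemma minkowski_functional_set_nonempty:
  "norm x / \<rho> < t \<Longrightarrow> t \<in> {t. 0 < t \<and> (1 / t) *\<^sub>R x \<in> W}"
proof -
  assume t: "norm x / \<rho> < t"
  have "0 \<le> norm x / \<rho>" using W by simp
  then have t0: "0 < t" using t by linarith
  have "norm ((1 / t) *\<^sub>R x) < \<rho>" using t t0 W(3) by (simp add: field_simps)
  then show ?thesis using t0 W(2) by auto
qed

lemma minkowski_functional_nonneg: "0 \<le> minkowski_functional W x"
  unfolding minkowski_functional_def
  using minkowski_functional_set_nonempty[of x "norm x / \<rho> + 1"]
  by (intro cInf_greatest) (auto simp del: divide_const_simps)

lemma minkowski_functional_less:
  assumes "minkowski_functional W x < t"
  shows "0 < t \<and> (1 / t) *\<^sub>R x \<in> W"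
proof -
  have "{t. 0 < t \<and> (1 / t) *\<^sub>R x \<in> W} \<noteq> {}"
    using minkowski_functional_set_nonempty[of x "norm x / \<rho> + 1"] by (auto simp del: divide_const_simps)
  then obtain s where s: "0 < s" "(1 / s) *\<^sub>R x \<in> W" "s < t"
    using assms unfolding minkowski_functional_def by (metis (mono_tags, lifting) cInf_lessD mem_Collect_eq)
  have "0 \<in> W" using W by auto
  then have "(s / t) *\<^sub>R ((1 / s) *\<^sub>R x) + (1 - s / t) *\<^sub>R 0 \<in> W"
    using s W(1) by (intro convexD) (auto simp: field_simps)
  then show ?thesis using s by simp
qed

lemma bounded_gauge_minkowski_functional: "bounded_gauge (1 / \<rho>) (minkowski_functional W)"
proof -
  let ?p = "minkowski_functional W"
  have add: "?p (x + y) \<le> ?p x + ?p y" for x y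
  proof (rule field_le_epsilon)
    fix e :: real assume e: "0 < e"
    let ?s = "?p x + e / 2" and ?t = "?p y + e / 2"
    have s: "0 < ?s \<and> (1 / ?s) *\<^sub>R x \<in> W" by (rule minkowski_functional_less) (use e in simp)
    have t: "0 < ?t \<and> (1 / ?t) *\<^sub>R y \<in> W" by (rule minkowski_functional_less) (use e in simp)
    have "(?s / (?s + ?t)) *\<^sub>R ((1 / ?s) *\<^sub>R x) + (?t / (?s + ?t)) *\<^sub>R ((1 / ?t) *\<^sub>R y) \<in> W"
      using s t W(1) by (intro convexD) (auto simp add: divide_simps simp del: add_divide_distrib)
    also have "(?s / (?s + ?t)) *\<^sub>R ((1 / ?s) *\<^sub>R x) + (?t / (?s + ?t)) *\<^sub>R ((1 / ?t) *\<^sub>R y)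
        = (1 / (?s + ?t)) *\<^sub>R (x + y)"
      using s t by (simp add: scaleR_add_right)
    finally have "?p (x + y) \<le> ?s + ?t" using s t by (intro minkowski_functional_le) auto
    then show "?p (x + y) \<le> ?p x + ?p y + e" by simp
  qed
  have le: "?p (a *\<^sub>R x) \<le> a * ?p x" if "0 < a" for a x
  proof (rule field_le_epsilon)
    fix e :: real assume e: "0 < e"
    let ?s = "?p x + e / a"
    have s: "0 < ?s \<and> (1 / ?s) *\<^sub>R x \<in> W" by (rule minkowski_functional_less) (use e that in simp)
    then have "?p (a *\<^sub>R x) \<le> a * ?s" using that by (intro minkowski_functional_le) auto
    then show "?p (a *\<^sub>R x) \<le> a * ?p x + e" using that by (simp add: distrib_left)
  qed
  have bnd: "?p x \<le> 1 / \<rho> * norm x" for x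
  proof (rule field_le_epsilon)
    fix e :: real assume e: "0 < e"
    show "?p x \<le> 1 / \<rho> * norm x + e"
      using minkowski_functional_set_nonempty[of x "1 / \<rho> * norm x + e"] e
      by (intro minkowski_functional_le) auto
  qed
  have scale: "?p (a *\<^sub>R x) = a * ?p x" if "0 \<le> a" for a x
  proof (cases "a = 0")
    case True
    then show ?thesis using bnd[of 0] minkowski_functional_nonneg[of 0] by simp
  next
    case False
    then have a: "0 < a" using that by simp
    have "?p x \<le> (1 / a) * ?p (a *\<^sub>R x)" using le[of "1 / a" "a *\<^sub>R x"] a by simp
    then have "a * ?p x \<le> ?p (a *\<^sub>R x)" using a by (simp add: field_simps)
    then show ?thesis using le[OF a, of x] by simp
  qed
  show ?thesis unfolding bounded_gauge_def
    using add scale bnd minkowski_functional_nonneg by blast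
qed

lemma minkowski_functional_less_1:
  assumes "open W"
  shows "{x. minkowski_functional W x < 1} = W"
proof (intro equalityI subsetI)
  fix x assume "x \<in> {x. minkowski_functional W x < 1}"
  then show "x \<in> W" using minkowski_functional_less[of x 1] by simp
next
  fix x assume x: "x \<in> W"
  have "((\<lambda>t. (1 / t) *\<^sub>R x) \<longlongrightarrow> (1 / 1) *\<^sub>R x) (at_left 1)"
    by (intro tendsto_intros) auto
  then have "\<forall>\<^sub>F t in at_left 1. (1 / t) *\<^sub>R x \<in> W"
    using assms x by (auto dest: topological_tendstoD)
  moreover have "\<forall>\<^sub>F t in at_left (1::real). t \<in> {0<..<1}"
    by (rule eventually_at_left_real) simp
  ultimately have "\<forall>\<^sub>F t in at_left (1::real). (1 / t) *\<^sub>R x \<in> W \<and> 0 < t \<and> t < 1"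
    by eventually_elim auto
  then obtain t where "(1 / t) *\<^sub>R x \<in> W" "0 < t" "t < 1"
    by (metis (no_types, lifting) eventually_happens' trivial_limit_at_left_real)
  then show "x \<in> {x. minkowski_functional W x < 1}" using minkowski_functional_le[of t x] by simp
qed

end

lemma bounded_gauge_limit:
  assumes "\<And>n. bounded_gauge C (p n)" "\<And>x. (\<lambda>n. p n x) \<longlonglongrightarrow> q x"
  shows "bounded_gauge C q"
  unfolding bounded_gauge_def
proof (intro conjI allI impI)
  fix x y a
  show "q (x + y) \<le> q x + q y"
    by (rule LIMSEQ_le[OF assms(2) tendsto_add[OF assms(2) assms(2)]])
      (use bounded_gauge_add[OF assms(1)] in blast)
  show "0 \<le> q x"
    by (rule LIMSEQ_le_const[OF assms(2)]) (use bounded_gauge_nonneg[OF assms(1)] in blast)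
  show "q x \<le> C * norm x"
    by (rule LIMSEQ_le_const2[OF assms(2)]) (use bounded_gauge_bound[OF assms(1)] in blast)
  show "q (a *\<^sub>R x) = a * q x" if "0 \<le> a"
  proof (rule LIMSEQ_unique[OF assms(2)])
    have "(\<lambda>n. p n (a *\<^sub>R x)) = (\<lambda>n. a * p n x)"
      using bounded_gauge_scale[OF assms(1) that] by auto
    then show "(\<lambda>n. p n (a *\<^sub>R x)) \<longlonglongrightarrow> a * q x" using tendsto_mult_left[OF assms(2)] by simp
  qed
qed

lemma bounded_gauge_selection:
  fixes p :: "nat \<Rightarrow> 'a::euclidean_space \<Rightarrow> real"
  assumes p: "\<And>n. bounded_gauge C (p n)" and C: "0 < C"
  obtains r q where "strict_mono r" "bounded_gauge C q"
    "\<And>R e. 0 < e \<Longrightarrow> \<forall>\<^sub>F n in sequentially. \<forall>x. norm x \<le> R \<longrightarrow> \<bar>p (r n) x - q x\<bar> < e"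
proof -
  have bnd: "norm (p n x) \<le> C" if "x \<in> cball 0 1" for n x
  proof -
    have "C * norm x \<le> C * 1" using that C by (intro mult_left_mono) auto
    then show ?thesis using bounded_gauge_nonneg[OF p, of n x] bounded_gauge_bound[OF p, of n x] by simp
  qed
  have "\<exists>d>0. \<forall>n y. y \<in> cball 0 1 \<and> norm (x - y) < d \<longrightarrow> norm (p n x - p n y) < e"
    if "0 < e" for x :: 'a and e
  proof (intro exI[of _ "e / C"] conjI allI impI)
    fix n y assume "y \<in> cball 0 1 \<and> norm (x - y) < e / C"
    then have "C * norm (x - y) < e" using C by (simp add: field_simps)
    then show "norm (p n x - p n y) < e" using bounded_gauge_diff[OF p, of n x y] by simp
  qed (use C that in simp)
  then obtain g k where k: "strict_mono (k :: nat \<Rightarrow> nat)"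
    and g: "\<And>e. 0 < e \<Longrightarrow> \<exists>N. \<forall>n x. n \<ge> N \<and> x \<in> cball 0 1 \<longrightarrow> norm (p (k n) x - g x) < e"
    using Arzela_Ascoli[of "cball (0::'a) 1" p C] bnd by (metis compact_cball)
  define q where "q x = norm x * g ((1 / norm x) *\<^sub>R x)" for x
  have unif: "\<forall>\<^sub>F n in sequentially. \<forall>x. norm x \<le> R \<longrightarrow> \<bar>p (k n) x - q x\<bar> < e" if e: "0 < e" for R e
  proof -
    define R' where "R' = max R 1"
    have R': "1 \<le> R'" "R \<le> R'" by (auto simp: R'_def)
    obtain N where N: "\<And>n x. n \<ge> N \<Longrightarrow> x \<in> cball 0 1 \<Longrightarrow> norm (p (k n) x - g x) < e / R'"
      using g[of "e / R'"] e R' by auto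
    have "\<bar>p (k n) x - q x\<bar> < e" if "n \<ge> N" "norm x \<le> R" for n x
    proof (cases "x = 0")
      case True
      then show ?thesis
        using e bounded_gauge_nonneg[OF p, of "k n" 0] bounded_gauge_bound[OF p, of "k n" 0] by (simp add: q_def)
    next
      case False
      let ?u = "(1 / norm x) *\<^sub>R x"
      have "p (k n) x = norm x * p (k n) ?u"
        using bounded_gauge_scale[OF p, of "norm x" "k n" ?u] False by simp
      then have "\<bar>p (k n) x - q x\<bar> = norm x * \<bar>p (k n) ?u - g ?u\<bar>"
        by (simp add: q_def right_diff_distrib[symmetric] abs_mult)
      also have "\<dots> \<le> R' * \<bar>p (k n) ?u - g ?u\<bar>"
        using that R' by (intro mult_right_mono) auto
      also have "\<dots> < R' * (e / R')"
        using N[of n ?u] that(1) False R' by (intro mult_strict_left_mono) auto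
      finally show ?thesis using R' by simp
    qed
    then show ?thesis unfolding eventually_sequentially by blast
  qed
  have "(\<lambda>n. p (k n) x) \<longlonglongrightarrow> q x" for x
  proof (rule tendstoI)
    fix e :: real assume "0 < e"
    from unif[OF this, of "norm x"] show "\<forall>\<^sub>F n in sequentially. dist (p (k n) x) (q x) < e"
      by eventually_elim (simp add: dist_real_def)
  qed
  then have "bounded_gauge C q" using bounded_gauge_limit[of C "\<lambda>n. p (k n)" q] p by blast
  then show ?thesis using that k unif by blast
qed

lemma hausdorff_edist_le:
  assumes "\<And>x. x \<in> A \<Longrightarrow> \<exists>y\<in>B. dist x y \<le> e" "\<And>y. y \<in> B \<Longrightarrow> \<exists>x\<in>A. dist x y \<le> e"
  shows "hausdorff_edist A B \<le> ennreal e"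
  unfolding hausdorff_edist_def
proof (intro max.boundedI SUP_least)
  fix x assume "x \<in> A"
  with assms(1) obtain y where "y \<in> B" "dist x y \<le> e" by blast
  then show "(INF y\<in>B. ennreal (dist x y)) \<le> ennreal e"
    by (meson INF_lower2 ennreal_leI)
next
  fix y assume "y \<in> B"
  with assms(2) obtain x where "x \<in> A" "dist x y \<le> e" by blast
  then show "(INF x\<in>A. ennreal (dist x y)) \<le> ennreal e"
    by (meson INF_lower2 ennreal_leI)
qed

lemma bounded_gauge_approx:
  assumes "bounded_gauge C p" "bounded_gauge C q" "0 < e" "0 < R"
    and "\<And>x. norm x \<le> R \<Longrightarrow> \<bar>p x - q x\<bar> < e / R"
    and "p x \<le> 1" "norm x \<le> R"
  shows "\<exists>y. q y \<le> 1 \<and> norm y \<le> R \<and> dist x y \<le> e"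
proof (intro exI conjI)
  let ?u = "1 / (1 + e / R)"
  have u: "0 \<le> ?u" "?u \<le> 1" "(1 - ?u) * R \<le> e" using assms(3,4)
    by (simp_all add: field_simps)
  have "q x \<le> 1 + e / R" using assms(5)[of x] assms(6,7) by linarith
  then have "?u * q x \<le> 1" using assms(3,4) by (simp add: field_simps add_pos_pos)
  then show "q (?u *\<^sub>R x) \<le> 1" using bounded_gauge_scale[OF assms(2) u(1)] by simp
  have "?u * norm x \<le> 1 * R" using u assms by (intro mult_mono) auto
  then show "norm (?u *\<^sub>R x) \<le> R" using u by simp
  have "x - ?u *\<^sub>R x = (1 - ?u) *\<^sub>R x" by (simp add: scaleR_diff_left)
  then have "dist x (?u *\<^sub>R x) = (1 - ?u) * norm x" using u by (simp only: dist_norm norm_scaleR)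
  also have "\<dots> \<le> (1 - ?u) * R" using u assms by (intro mult_left_mono) auto
  finally show "dist x (?u *\<^sub>R x) \<le> e" using u by linarith
qed

lemma bounded_gauge_local_hausdorff:
  fixes p :: "nat \<Rightarrow> complex ^ 'd \<Rightarrow> real"
  assumes p: "\<And>n. bounded_gauge C (p n)" and q: "bounded_gauge C q"
    and unif: "\<And>R e. 0 < e \<Longrightarrow> \<forall>\<^sub>F n in sequentially. \<forall>x. norm x \<le> R \<longrightarrow> \<bar>p n x - q x\<bar> < e"
  shows "local_hausdorff_tendsto (\<lambda>n. {x. p n x < 1}) {x. q x < 1}"
  unfolding local_hausdorff_tendsto_def
proof (intro exI[of _ 1] conjI allI impI)
  fix R :: real assume R: "1 \<le> R"
  show "(\<lambda>n. hausdorff_edist (closure {x. p n x < 1} \<inter> closure (ball 0 R))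
       (closure {x. q x < 1} \<inter> closure (ball 0 R))) \<longlonglongrightarrow> 0"
  proof (rule order_tendstoI)
    fix e' :: ennreal assume "0 < e'"
    then obtain e where e: "0 < e" "ennreal e < e'"
    proof -
      obtain d where d: "0 < d" "d < e'" using dense[OF \<open>0 < e'\<close>] by blast
      then have "d \<noteq> top" by auto
      then obtain e where "0 \<le> e" "d = ennreal e" by (cases d) auto
      then show ?thesis using d that by simp
    qed
    have "\<forall>\<^sub>F n in sequentially. \<forall>x. norm x \<le> R \<longrightarrow> \<bar>p n x - q x\<bar> < e / R"
      using unif e R by simp
    then show "\<forall>\<^sub>F n in sequentially. hausdorff_edist (closure {x. p n x < 1} \<inter> closure (ball 0 R))
       (closure {x. q x < 1} \<inter> closure (ball 0 R)) < e'"
    proof eventually_elim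
      case (elim n)
      have "hausdorff_edist (closure {x. p n x < 1} \<inter> closure (ball 0 R))
         (closure {x. q x < 1} \<inter> closure (ball 0 R)) \<le> ennreal e"
      proof (rule hausdorff_edist_le)
        fix x assume "x \<in> closure {x. p n x < 1} \<inter> closure (ball 0 R)"
        then show "\<exists>y\<in>closure {x. q x < 1} \<inter> closure (ball 0 R). dist x y \<le> e"
          using bounded_gauge_approx[OF p[of n] q e(1), of R x] elim R
          by (auto simp: bounded_gauge_closure[OF p] bounded_gauge_closure[OF q])
      next
        fix x assume "x \<in> closure {x. q x < 1} \<inter> closure (ball 0 R)"
        then show "\<exists>y\<in>closure {x. p n x < 1} \<inter> closure (ball 0 R). dist y x \<le> e"
          using bounded_gauge_approx[OF q p[of n] e(1), of R x] elim R
          by (auto simp: bounded_gauge_closure[OF p] bounded_gauge_closure[OF q] dist_commute abs_minus_commute)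
      qed
      then show ?case using e by simp
    qed
  qed simp
qed simp

section \<open>Discs in convex domains and affine rescaling\<close>

lemma norm_vector_smult: "norm (c *s v) = norm c * norm (v :: complex ^ 'n)"
  by (simp add: norm_vec_def norm_mult L2_set_right_distrib)

lemma scaleR_eq_vector_smult: "r *\<^sub>R v = complex_of_real r *s (v :: complex ^ 'n)"
  by (simp add: vec_eq_iff scaleR_conv_of_real[where 'a = complex])

lemma tendsto_vector_smult [tendsto_intros]:
  fixes g :: "'a \<Rightarrow> complex ^ 'n"
  assumes "(f \<longlongrightarrow> c) F" "(g \<longlongrightarrow> v) F"
  shows "((\<lambda>x. f x *s g x) \<longlongrightarrow> c *s v) F"
  by (rule vec_tendstoI) (use assms in \<open>auto intro!: tendsto_intros\<close>)

lemma tendsto_matrix_vector_mult [tendsto_intros]: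
  fixes M :: "complex ^ 'n ^ 'm"
  assumes "(g \<longlongrightarrow> v) F"
  shows "((\<lambda>x. M *v g x) \<longlongrightarrow> M *v v) F"
  by (rule vec_tendstoI) (use assms in \<open>auto intro!: tendsto_intros simp: matrix_vector_mult_def\<close>)

lemma norm_le_card_complex_vec:
  fixes z :: "complex ^ 'n"
  assumes "\<And>i. cmod (z $ i) \<le> B"
  shows "norm z \<le> real CARD('n) * B"
proof -
  have "norm z \<le> (\<Sum>i\<in>UNIV. cmod (z $ i))"
    unfolding norm_vec_def by (rule L2_set_le_sum) simp
  also have "\<dots> \<le> real CARD('n) * B"
    using sum_bounded_above[of UNIV "\<lambda>i. cmod (z $ i)" B] assms by simp
  finally show ?thesis .
qed

definition disc_dirs :: "(complex ^ 'd) set \<Rightarrow> complex ^ 'd \<Rightarrow> (complex ^ 'd) set"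
  where "disc_dirs W x = {v. \<forall>c. cmod c \<le> 1 \<longrightarrow> x + c *s v \<in> closure W}"

lemma disc_dirsD: "v \<in> disc_dirs W x \<Longrightarrow> cmod c \<le> 1 \<Longrightarrow> x + c *s v \<in> closure W"
  unfolding disc_dirs_def by blast

lemma closed_disc_dirs: "closed (disc_dirs W x)"
  unfolding closed_sequential_limits
proof (intro allI impI, elim conjE)
  fix f l assume f: "\<forall>n. f n \<in> disc_dirs W x" "f \<longlonglongrightarrow> l"
  show "l \<in> disc_dirs W x"
    unfolding disc_dirs_def
  proof (intro CollectI allI impI)
    fix c :: complex assume "cmod c \<le> 1"
    then have "\<forall>n. x + c *s f n \<in> closure W" using f disc_dirsD by blast
    moreover have "(\<lambda>n. x + c *s f n) \<longlonglongrightarrow> x + c *s l" by (intro tendsto_intros f)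
    ultimately show "x + c *s l \<in> closure W" by (meson closed_closure closed_sequentially)
  qed
qed

lemma C_properly_convex_domainD:
  assumes "C_properly_convex_domain \<Omega>"
  shows "open \<Omega>" "convex \<Omega>" "\<Omega> \<noteq> {}"
    and "v \<noteq> 0 \<Longrightarrow> \<exists>c. p + c *s v \<notin> \<Omega>"
  using assms unfolding C_properly_convex_domain_def by blast+

lemma convex_shrink_open:
  fixes S :: "'a::euclidean_space set"
  assumes "convex S" "open S" "y \<in> S" "y + u \<in> closure S" "0 \<le> t" "t < 1"
  shows "y + t *\<^sub>R u \<in> S"
proof -
  have "(y + u) - (1 - t) *\<^sub>R ((y + u) - y) \<in> interior S"
    by (rule mem_interior_closure_convex_shrink) (use assms in \<open>auto simp: interior_open\<close>)
  then show ?thesis using assms(2) by (simp add: interior_open scaleR_diff_left)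
qed

lemma disc_dirs_bounded:
  assumes \<Omega>: "C_properly_convex_domain \<Omega>"
  shows "\<exists>M>0. \<forall>y\<in>closure \<Omega>. norm y \<le> R \<longrightarrow> (\<forall>v\<in>disc_dirs \<Omega> y. norm v \<le> M)"
proof (rule ccontr)
  assume "\<not> ?thesis"
  then have neg: "\<exists>y\<in>closure \<Omega>. norm y \<le> R \<and> (\<exists>v\<in>disc_dirs \<Omega> y. norm v > M)" if "M > 0" for M
    using that by (metis not_le)
  have "\<exists>y v. y \<in> closure \<Omega> \<and> norm y \<le> R \<and> v \<in> disc_dirs \<Omega> y \<and> norm v > real (Suc n)" for n
    using neg[of "real (Suc n)"] by (metis of_nat_0_less_iff zero_less_Suc)
  then obtain y v where y: "\<And>n. y n \<in> closure \<Omega>" "\<And>n. norm (y n) \<le> R"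
    and v: "\<And>n. v n \<in> disc_dirs \<Omega> (y n)" "\<And>n. norm (v n) > real (Suc n)"
    by metis
  note D = C_properly_convex_domainD[OF \<Omega>]
  obtain w where w: "w \<in> \<Omega>" using D(3) by blast
  define u where "u n = inverse (norm (v n)) *\<^sub>R v n" for n
  have vpos: "0 < norm (v n)" for n using v(2)[of n] by linarith
  have "bounded (range u)"
    unfolding bounded_iff using vpos by (intro exI[of _ 1]) (auto simp: u_def)
  then obtain l r where l: "strict_mono r" "(u \<circ> r) \<longlonglongrightarrow> l"
    using bounded_imp_convergent_subsequence by blast
  have "norm (u n) = 1" for n using vpos[of n] by (simp add: u_def)
  then have "norm l = 1"
    using tendsto_norm[OF l(2)] by (simp add: o_def LIMSEQ_const_iff)
  then have "l \<noteq> 0" by auto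
  have inv: "(\<lambda>n. inverse (norm (v (r n)))) \<longlonglongrightarrow> 0"
  proof (rule real_tendsto_sandwich[of "\<lambda>_. 0"])
    show "\<forall>\<^sub>F n in sequentially. inverse (norm (v (r n))) \<le> inverse (real (Suc n))"
    proof (intro always_eventually allI le_imp_inverse_le)
      fix n
      have "n \<le> r n" by (rule strict_mono_imp_increasing[OF l(1)])
      then show "real (Suc n) \<le> norm (v (r n))" using v(2)[of "r n"] by simp
    qed simp
  qed (use LIMSEQ_inverse_real_of_nat in auto)
  have closure: "w + c *s l \<in> closure \<Omega>" for c
  proof -
    let ?t = "\<lambda>n. cmod c * inverse (norm (v (r n)))"
    let ?x = "\<lambda>n. (1 - ?t n) *\<^sub>R w + ?t n *\<^sub>R y (r n) + c *s u (r n)"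
    have t: "?t \<longlonglongrightarrow> 0" using tendsto_mult_left[OF inv, of "cmod c"] by simp
    then have "\<forall>\<^sub>F n in sequentially. ?t n < 1" by (rule order_tendstoD(2)) simp
    then have "\<forall>\<^sub>F n in sequentially. ?x n \<in> closure \<Omega>"
    proof eventually_elim
      case (elim n)
      have "y (r n) + sgn c *s v (r n) \<in> closure \<Omega>"
        by (rule disc_dirsD[OF v(1)]) (simp add: norm_sgn)
      then have "(1 - ?t n) *\<^sub>R w + ?t n *\<^sub>R (y (r n) + sgn c *s v (r n)) \<in> closure \<Omega>"
        using w closure_subset[of \<Omega>] elim D(2) by (intro convexD[OF convex_closure]) auto
      moreover have "?t n *\<^sub>R (sgn c *s v (r n)) = c *s u (r n)"
        by (simp add: u_def scaleR_eq_vector_smult sgn_eq)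
      ultimately show ?case by (simp add: scaleR_add_right add.assoc)
    qed
    moreover have "?x \<longlonglongrightarrow> (1 - 0) *\<^sub>R w + 0 + c *s l"
    proof (intro tendsto_intros t)
      show "(\<lambda>n. u (r n)) \<longlonglongrightarrow> l" using l(2) by (simp add: o_def)
      show "(\<lambda>n. ?t n *\<^sub>R y (r n)) \<longlonglongrightarrow> 0"
        by (rule lim_null_scaleR_bounded[OF t, of _ R]) (simp add: y(2))
    qed
    ultimately show ?thesis
      using Lim_in_closed_set[OF closed_closure _ trivial_limit_sequentially] by simp
  qed
  have "w + c *s l \<in> \<Omega>" for c
  proof -
    have "w + (2 * c) *s l \<in> closure \<Omega>" by (rule closure)
    then have "w + (1 / 2) *\<^sub>R ((2 * c) *s l) \<in> \<Omega>"
      by (intro convex_shrink_open) (use D w in auto)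
    then show ?thesis by (simp add: scaleR_eq_vector_smult)
  qed
  then show False using D(4)[OF \<open>l \<noteq> 0\<close>, of w] by blast
qed


text \<open>The rows of a matrix in the compact set of matrices with rows in \<open>S\<close> whose determinant
  has maximal modulus form an Auerbach basis: by Cramer's rule, the coordinates of a point of
  \<open>S\<close> are quotients of such determinants by the maximal one.\<close>

lemma auerbach_basis:
  fixes S :: "(complex ^ 'n) set"
  assumes "compact S" "cball 0 e \<subseteq> S" "0 < e"
  obtains M :: "complex ^ 'n ^ 'n" where "invertible M" "\<And>i. column i M \<in> S"
    "\<And>v. v \<in> S \<Longrightarrow> \<exists>z. v = M *v z \<and> (\<forall>i. cmod (z $ i) \<le> 1)"
proof -
  define \<K> where "\<K> = {V :: complex ^ 'n ^ 'n. \<forall>i. V $ i \<in> S}"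
  have "closed \<K>"
    unfolding \<K>_def
    by (intro closed_Collect_all closed_vimage[unfolded vimage_def] compact_imp_closed assms(1)
        continuous_intros)
  moreover have "bounded \<K>"
  proof -
    obtain B where B: "\<And>v. v \<in> S \<Longrightarrow> norm v \<le> B"
      using compact_imp_bounded[OF assms(1)] unfolding bounded_iff by blast
    have "norm V \<le> real CARD('n) * B" if "V \<in> \<K>" for V
    proof -
      have "norm V \<le> (\<Sum>i\<in>UNIV. norm (V $ i))"
        unfolding norm_vec_def[of V] by (rule L2_set_le_sum) simp
      also have "\<dots> \<le> real CARD('n) * B"
        using sum_bounded_above[of UNIV "\<lambda>i. norm (V $ i)" B] that B by (simp add: \<K>_def)
      finally show ?thesis .
    qed
    then show ?thesis unfolding bounded_iff by blast
  qed
  ultimately have "compact \<K>" by (simp add: compact_eq_bounded_closed)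
  define V0 :: "complex ^ 'n ^ 'n" where "V0 = (\<chi> i j. if i = j then complex_of_real e else 0)"
  have "norm (V0 $ i) \<le> e" for i
  proof -
    have "(\<Sum>j\<in>UNIV. (norm (V0 $ i $ j))\<^sup>2) = e\<^sup>2"
      by (simp add: V0_def if_distrib[of norm] if_distrib[of "\<lambda>x. x ^ 2"] cong: if_cong)
    then show ?thesis using assms(3) by (simp add: norm_vec_def L2_set_def)
  qed
  then have V0: "V0 \<in> \<K>" using assms(2) by (auto simp: \<K>_def)
  have "continuous_on \<K> (\<lambda>V. norm (det V))"
    unfolding det_def by (intro continuous_intros)
  then obtain V where V: "V \<in> \<K>" and max: "\<And>U. U \<in> \<K> \<Longrightarrow> norm (det U) \<le> norm (det V)"
    using continuous_attains_sup[OF \<open>compact \<K>\<close>] V0 by blast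
  have "det V0 = (\<Prod>i\<in>UNIV. V0 $ i $ i)" by (rule det_diagonal) (simp add: V0_def)
  then have "det V0 \<noteq> 0" using assms(3) by (simp add: V0_def)
  then have det: "det V \<noteq> 0" using max[OF V0] by auto
  define M where "M = transpose V"
  have inv: "invertible M" using det by (simp add: M_def invertible_det_nz)
  then obtain N where N: "M ** N = mat 1" unfolding invertible_def by blast
  have Mz: "M *v z = (\<Sum>i\<in>UNIV. z $ i *s row i V)" for z
    by (simp add: M_def matrix_mult_sum)
  show ?thesis
  proof (rule that[OF inv])
    show "column i M \<in> S" for i
      using V by (simp add: M_def \<K>_def row_def)
    fix v assume v: "v \<in> S"
    define z where "z = N *v v"
    have vz: "v = M *v z" using N by (simp add: z_def matrix_vector_mul_assoc)
    have "cmod (z $ k) \<le> 1" for k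
    proof -
      let ?U = "\<chi> i. if i = k then v else row i V"
      have "det ?U = z $ k * det V"
        using cramer_lemma_transpose[of k z V] unfolding vz Mz .
      moreover have "?U \<in> \<K>" using V v by (simp add: \<K>_def row_def)
      then have "cmod (det ?U) \<le> cmod (det V)" by (rule max)
      ultimately show ?thesis using det by (simp add: norm_mult)
    qed
    then show "\<exists>z. v = M *v z \<and> (\<forall>i. cmod (z $ i) \<le> 1)" using vz by blast
  qed
qed

lemma affine_normalisation:
  fixes \<Omega> :: "(complex ^ 'd) set"
  assumes \<Omega>: "C_properly_convex_domain \<Omega>" and y: "y \<in> \<Omega>"
  obtains M :: "complex ^ 'd ^ 'd" where "invertible M"
    "\<And>z. norm z \<le> 1 / real CARD('d) \<Longrightarrow> y + M *v z \<in> closure \<Omega>"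
    "\<And>v. v \<in> disc_dirs \<Omega> y \<Longrightarrow> \<exists>z. v = M *v z \<and> (\<forall>i. cmod (z $ i) \<le> 1)"
proof -
  note D = C_properly_convex_domainD[OF \<Omega>]
  let ?S = "disc_dirs \<Omega> y"
  have "bounded ?S"
    using disc_dirs_bounded[OF \<Omega>, of "norm y"] y closure_subset[of \<Omega>] unfolding bounded_iff by blast
  then have "compact ?S" using closed_disc_dirs by (simp add: compact_eq_bounded_closed)
  obtain e where e: "0 < e" "cball y e \<subseteq> \<Omega>" using D(1) y open_contains_cball by blast
  have "cball 0 e \<subseteq> ?S"
  proof
    fix v :: "complex ^ 'd" assume v: "v \<in> cball 0 e"
    have "y + c *s v \<in> cball y e" if "cmod c \<le> 1" for c
      using mult_mono[of "cmod c" 1 "norm v" e] that v by (simp add: dist_norm norm_vector_smult)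
    then show "v \<in> ?S" using e closure_subset[of \<Omega>] unfolding disc_dirs_def by blast
  qed
  from auerbach_basis[OF \<open>compact ?S\<close> this e(1)]
  obtain M :: "complex ^ 'd ^ 'd" where M: "invertible M" "\<And>i. column i M \<in> ?S"
    "\<And>v. v \<in> ?S \<Longrightarrow> \<exists>z. v = M *v z \<and> (\<forall>i. cmod (z $ i) \<le> 1)" by metis
  have "y + M *v z \<in> closure \<Omega>" if z: "norm z \<le> 1 / real CARD('d)" for z
  proof -
    let ?n = "real CARD('d)"
    have n: "0 < ?n" by simp
    have "y + (complex_of_real ?n * z $ i) *s column i M \<in> closure \<Omega>" for i
    proof (rule disc_dirsD[OF M(2)])
      have "cmod (z $ i) \<le> 1 / ?n" using Finite_Cartesian_Product.norm_nth_le[of z i] z by simp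
      then have "?n * cmod (z $ i) \<le> 1" using n by (simp add: field_simps)
      then show "cmod (complex_of_real ?n * z $ i) \<le> 1" by (simp add: norm_mult)
    qed
    then have "(\<Sum>i\<in>UNIV. (1 / ?n) *\<^sub>R (y + (complex_of_real ?n * z $ i) *s column i M)) \<in> closure \<Omega>"
      by (intro convex_sum) (use D(2) in auto)
    also have "(\<Sum>i\<in>UNIV. (1 / ?n) *\<^sub>R (y + (complex_of_real ?n * z $ i) *s column i M)) = y + M *v z"
      by (simp add: scaleR_add_right sum.distrib matrix_mult_sum sum_constant_scaleR del: sum_constant)
        (simp add: scaleR_eq_vector_smult vector_smult_assoc)
    finally show ?thesis .
  qed
  then show ?thesis using that M by blast
qed

lemma bounded_gauge_moving_limit:
  fixes p :: "nat \<Rightarrow> 'a::euclidean_space \<Rightarrow> real"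
  assumes p: "\<And>n. bounded_gauge C (p n)" and lim: "(\<lambda>n. p n x) \<longlonglongrightarrow> l" and z: "z \<longlonglongrightarrow> x"
  shows "(\<lambda>n. p n (z n)) \<longlonglongrightarrow> l"
proof -
  have "(\<lambda>n. p n (z n) - p n x) \<longlonglongrightarrow> 0"
  proof (rule Lim_null_comparison)
    show "\<forall>\<^sub>F n in sequentially. norm (p n (z n) - p n x) \<le> C * norm (z n - x)"
      using bounded_gauge_diff[OF p] by simp
    have "(\<lambda>n. C * norm (z n - x)) \<longlonglongrightarrow> C * norm (x - x)" by (intro tendsto_intros z)
    then show "(\<lambda>n. C * norm (z n - x)) \<longlonglongrightarrow> 0" by simp
  qed
  from tendsto_add[OF this lim] show ?thesis by simp
qed


lemma disc_dirs_convex_combination: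
  assumes "convex \<Omega>" "o' \<in> closure \<Omega>" "v \<in> disc_dirs \<Omega> x" "0 \<le> t" "t \<le> 1"
  shows "(1 - t) *\<^sub>R v \<in> disc_dirs \<Omega> ((1 - t) *\<^sub>R x + t *\<^sub>R o')"
  unfolding disc_dirs_def
proof (intro CollectI allI impI)
  fix c :: complex assume "cmod c \<le> 1"
  then have "(1 - t) *\<^sub>R (x + c *s v) + t *\<^sub>R o' \<in> closure \<Omega>"
    using assms disc_dirsD[OF assms(3)] by (intro convexD[OF convex_closure]) auto
  then show "(1 - t) *\<^sub>R x + t *\<^sub>R o' + c *s (1 - t) *\<^sub>R v \<in> closure \<Omega>"
    by (simp add: algebra_simps scaleR_eq_vector_smult vector_smult_assoc)
qed

lemma disc_dirs_scale:
  assumes "v \<in> disc_dirs \<Omega> x" "cmod k \<le> 1"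
  shows "k *s v \<in> disc_dirs \<Omega> x"
  unfolding disc_dirs_def
proof (intro CollectI allI impI)
  fix c :: complex assume "cmod c \<le> 1"
  then have "cmod (c * k) \<le> 1" using assms(2) by (simp add: norm_mult mult_le_one)
  then show "x + c *s (k *s v) \<in> closure \<Omega>"
    using disc_dirsD[OF assms(1)] by (simp add: vector_smult_assoc)
qed

definition affine_preimage :: "complex ^ 'd ^ 'd \<Rightarrow> complex ^ 'd \<Rightarrow> (complex ^ 'd) set \<Rightarrow> (complex ^ 'd) set"
  where "affine_preimage M y \<Omega> = {z. y + M *v z \<in> \<Omega>}"

lemma affine_preimage_eq_image:
  assumes "invertible M"
  shows "\<exists>A\<in>complex_affine_automorphisms. A ` \<Omega> = affine_preimage M y \<Omega>"
proof -
  obtain N where N: "M ** N = mat 1" "N ** M = mat 1"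
    using assms unfolding invertible_def by blast
  then have inv: "invertible N" unfolding invertible_def by blast
  let ?A = "\<lambda>z. N *v z + N *v (- y)"
  have A: "?A z = N *v (z - y)" for z
    by (simp add: matrix_vector_mult_diff_distrib matrix_vector_mult_add_rdistrib[symmetric] vec.neg)
  have "?A ` \<Omega> = affine_preimage M y \<Omega>"
  proof (intro equalityI subsetI)
    fix z assume "z \<in> ?A ` \<Omega>"
    then show "z \<in> affine_preimage M y \<Omega>"
      by (auto simp: A affine_preimage_def matrix_vector_mul_assoc N)
  next
    fix z assume "z \<in> affine_preimage M y \<Omega>"
    moreover have "z = ?A (y + M *v z)" by (simp add: A matrix_vector_mul_assoc N)
    ultimately show "z \<in> ?A ` \<Omega>" unfolding affine_preimage_def by blast
  qed
  then show ?thesis using inv unfolding complex_affine_automorphisms_def by blast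
qed

lemma matrix_vector_mult_scaleR_right:
  "M *v (r *\<^sub>R z) = r *\<^sub>R (M *v z)" for M :: "complex ^ 'n ^ 'm"
  by (simp add: scaleR_eq_vector_smult vec.scale)

lemma open_affine_preimage: "open \<Omega> \<Longrightarrow> open (affine_preimage M y \<Omega>)"
  unfolding affine_preimage_def
  by (intro open_vimage[unfolded vimage_def] continuous_intros)
    (auto simp: continuous_on_def intro!: tendsto_intros)

lemma convex_affine_preimage: "convex \<Omega> \<Longrightarrow> convex (affine_preimage M y \<Omega>)"
proof (rule convexI)
  fix x z and u v :: real
  assume *: "convex \<Omega>" "x \<in> affine_preimage M y \<Omega>" "z \<in> affine_preimage M y \<Omega>" "0 \<le> u" "0 \<le> v" "u + v = 1"
  have "u *\<^sub>R (y + M *v x) + v *\<^sub>R (y + M *v z) \<in> \<Omega>"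
    using * by (intro convexD) (auto simp: affine_preimage_def)
  also have "u *\<^sub>R (y + M *v x) + v *\<^sub>R (y + M *v z) = (u + v) *\<^sub>R y + M *v (u *\<^sub>R x + v *\<^sub>R z)"
    by (simp add: algebra_simps matrix_vector_mult_scaleR_right matrix_vector_right_distrib)
  finally show "u *\<^sub>R x + v *\<^sub>R z \<in> affine_preimage M y \<Omega>"
    using * by (simp add: affine_preimage_def)
qed

lemma scaling_limit:
  fixes \<Omega> :: "(complex ^ 'd) set" and M :: "nat \<Rightarrow> complex ^ 'd ^ 'd"
  assumes \<Omega>: "C_properly_convex_domain \<Omega>"
    and simple: "\<And>D. D \<in> affine_orbit_closure \<Omega> \<Longrightarrow> simple_boundary D"
    and y: "\<And>n. y n \<in> \<Omega>" and M: "\<And>n. invertible (M n)"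
    and M_ball: "\<And>n z. norm z \<le> 1 / real CARD('d) \<Longrightarrow> y n + M n *v z \<in> closure \<Omega>"
    and M_dirs: "\<And>n v. v \<in> disc_dirs \<Omega> (y n) \<Longrightarrow> \<exists>z. v = M n *v z \<and> (\<forall>i. cmod (z $ i) \<le> 1)"
    and q: "\<And>n. y n + M n *v q n \<in> closure \<Omega> - \<Omega>" "bounded (range q)"
    and w: "\<And>n. e \<le> norm (w n)" "0 < e" "bounded (range w)"
    and disc: "\<And>n c. cmod c \<le> 1 \<Longrightarrow> y n + M n *v ((1 - 1 / real (n + 2)) *\<^sub>R q n + c *s w n) \<in> closure \<Omega>"
  shows False
proof -
  note D = C_properly_convex_domainD[OF \<Omega>]
  let ?d = "real CARD('d)"
  define W where "W n = affine_preimage (M n) (y n) \<Omega>" for n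
  define \<rho> where "\<rho> = 1 / (2 * ?d)"
  have \<rho>: "0 < \<rho>" by (simp add: \<rho>_def)
  have W: "open (W n)" "convex (W n)" for n
    unfolding W_def using D(1,2) by (simp_all add: open_affine_preimage convex_affine_preimage)
  have shrink: "t *\<^sub>R z \<in> W n" if "y n + M n *v z \<in> closure \<Omega>" "0 \<le> t" "t < 1" for t z n
    using convex_shrink_open[OF D(2,1) y that]
    by (simp add: W_def affine_preimage_def matrix_vector_mult_scaleR_right)
  have Wball: "ball 0 \<rho> \<subseteq> W n" for n
  proof
    fix z :: "complex ^ 'd" assume "z \<in> ball 0 \<rho>"
    then have "norm (2 *\<^sub>R z) \<le> 1 / ?d" by (simp add: \<rho>_def)
    from shrink[OF M_ball[OF this], of "1 / 2"] show "z \<in> W n" by simp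
  qed
  define p where "p n = minkowski_functional (W n)" for n
  define C where "C = 1 / \<rho>"
  have C: "0 < C" using \<rho> by (simp add: C_def)
  have p: "bounded_gauge C (p n)" for n
    unfolding p_def C_def by (rule bounded_gauge_minkowski_functional[OF W(2) Wball \<rho>])
  have W_eq: "{z. p n z < 1} = W n" for n
    unfolding p_def by (rule minkowski_functional_less_1[OF W(2) Wball \<rho> W(1)])
  have p_le: "p n z \<le> 1" if "y n + M n *v z \<in> closure \<Omega>" for n z
  proof (rule field_le_epsilon)
    fix e :: real assume "0 < e"
    then show "p n z \<le> 1 + e"
      unfolding p_def using shrink[OF that, of "1 / (1 + e)"]
      by (intro minkowski_functional_le[OF W(2) Wball \<rho>]) (auto simp: field_simps)
  qed
  obtain r1 g where r1: "strict_mono r1" and g: "bounded_gauge C g"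
    and unif1: "\<And>R e. 0 < e \<Longrightarrow> \<forall>\<^sub>F n in sequentially. \<forall>x. norm x \<le> R \<longrightarrow> \<bar>p (r1 n) x - g x\<bar> < e"
    by (rule bounded_gauge_selection[OF p C]) (rule that)
  have "bounded (range (\<lambda>n. (q (r1 n), w (r1 n))))"
    by (rule bounded_subset[OF bounded_Times[OF q(2) w(3)]]) auto
  then obtain l r2 where l: "strict_mono (r2 :: nat \<Rightarrow> nat)" "((\<lambda>n. (q (r1 n), w (r1 n))) \<circ> r2) \<longlonglongrightarrow> l"
    using bounded_imp_convergent_subsequence by blast
  obtain q' w' where l_eq: "l = (q', w')" by (cases l)
  define r where "r = r1 \<circ> r2"
  have r: "strict_mono r" unfolding r_def using r1 l(1) by (rule strict_mono_o)
  have qlim: "(\<lambda>n. q (r n)) \<longlonglongrightarrow> q'" and wlim: "(\<lambda>n. w (r n)) \<longlonglongrightarrow> w'"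
    using tendsto_fst[OF l(2)] tendsto_snd[OF l(2)] by (simp_all add: l_eq r_def o_def)
  have unif: "\<forall>\<^sub>F n in sequentially. \<forall>x. norm x \<le> R \<longrightarrow> \<bar>p (r n) x - g x\<bar> < e" if "0 < e" for R e
    using eventually_subseq[OF l(1) unif1[OF that, of R]] by (simp add: r_def)
  have plim: "(\<lambda>n. p (r n) x) \<longlonglongrightarrow> g x" for x
  proof (rule tendstoI)
    fix e :: real assume "0 < e"
    from unif[OF this, of "norm x"] show "\<forall>\<^sub>F n in sequentially. dist (p (r n) x) (g x) < e"
      by eventually_elim (simp add: dist_real_def)
  qed
  define E where "E = {z. g z < 1}"
  have clE: "closure E = {z. g z \<le> 1}" unfolding E_def by (rule bounded_gauge_closure[OF g])
  have "C_properly_convex_domain E"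
    unfolding C_properly_convex_domain_def
  proof (intro conjI notI)
    have "g 0 \<le> 0" using bounded_gauge_bound[OF g, of 0] by simp
    then have "0 \<in> E" by (simp add: E_def)
    then show "E = {} \<Longrightarrow> False" by blast
    show "open E" "convex E"
      unfolding E_def using bounded_gauge_open[OF g] bounded_gauge_convex[OF g] by auto
    assume "\<exists>p v. v \<noteq> 0 \<and> range (\<lambda>c :: complex. p + c *s v) \<subseteq> E"
    then obtain x v where v: "v \<noteq> 0" and line: "\<And>c. g (x + c *s v) < 1"
      unfolding E_def by blast
    have g0: "g (c *s v) \<le> 0" for c
    proof (rule ccontr)
      assume "\<not> g (c *s v) \<le> 0"
      then have pos: "0 < g (c *s v)" by simp
      obtain k where k: "(1 + g (- x)) / g (c *s v) < real k" using reals_Archimedean2 by blast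
      have "real k * g (c *s v) = g ((complex_of_real (real k) * c) *s v)"
        using bounded_gauge_scale[OF g, of "real k" "c *s v"]
        by (simp add: scaleR_eq_vector_smult vector_smult_assoc)
      also have "\<dots> \<le> g (x + (complex_of_real (real k) * c) *s v) + g (- x)"
        using bounded_gauge_add[OF g, of "x + (complex_of_real (real k) * c) *s v" "- x"] by simp
      also have "\<dots> < 1 + g (- x)" using line by simp
      finally show False using k pos by (simp add: field_simps)
    qed
    obtain i where i: "v $ i \<noteq> 0" using v by (auto simp: vec_eq_iff)
    define u where "u = (2 / v $ i) *s v"
    have "\<forall>\<^sub>F n in sequentially. \<forall>x. norm x \<le> norm u \<longrightarrow> \<bar>p (r n) x - g x\<bar> < 1"
      by (rule unif) simp
    from eventually_happens[OF this]
    obtain n where n: "\<And>x. norm x \<le> norm u \<Longrightarrow> \<bar>p (r n) x - g x\<bar> < 1" by auto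
    have "M (r n) *v u \<in> disc_dirs \<Omega> (y (r n))"
      unfolding disc_dirs_def
    proof (intro CollectI allI impI)
      fix c :: complex assume c: "cmod c \<le> 1"
      have "norm (c *s u) \<le> norm u"
        using mult_right_mono[OF c, of "norm u"] by (simp add: norm_vector_smult)
      moreover have "g (c *s u) \<le> 0" unfolding u_def vector_smult_assoc by (rule g0)
      ultimately have "p (r n) (c *s u) < 1" using n[of "c *s u"] by linarith
      then have "c *s u \<in> W (r n)" using W_eq[of "r n"] by blast
      then show "y (r n) + c *s (M (r n) *v u) \<in> closure \<Omega>"
        using closure_subset[of \<Omega>] by (auto simp: W_def affine_preimage_def vec.scale)
    qed
    then obtain z :: "complex ^ 'd" where z: "M (r n) *v u = M (r n) *v z" "\<And>i. cmod (z $ i) \<le> 1"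
      using M_dirs by blast
    obtain N where "N ** M (r n) = mat 1" using M unfolding invertible_def by blast
    then have "N *v (M (r n) *v x) = x" for x by (simp add: matrix_vector_mul_assoc)
    then have "u = z" using z(1) by metis
    moreover have "u $ i = 2" using i by (simp add: u_def)
    ultimately show False using z(2)[of i] by simp
  qed
  moreover have "\<exists>A. (\<forall>n. A n \<in> complex_affine_automorphisms) \<and> local_hausdorff_tendsto (\<lambda>n. A n ` \<Omega>) E"
  proof -
    have "\<exists>A\<in>complex_affine_automorphisms. A ` \<Omega> = W (r n)" for n
      unfolding W_def by (rule affine_preimage_eq_image[OF M])
    then obtain A where A: "\<And>n. A n \<in> complex_affine_automorphisms" "\<And>n. A n ` \<Omega> = W (r n)"
      by metis
    have "local_hausdorff_tendsto (\<lambda>n. {x. p (r n) x < 1}) {x. g x < 1}"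
      using p g unif by (rule bounded_gauge_local_hausdorff)
    then have "local_hausdorff_tendsto (\<lambda>n. A n ` \<Omega>) E" by (simp add: A(2) W_eq E_def)
    then show ?thesis using A(1) by blast
  qed
  ultimately have "simple_boundary E" by (intro simple) (simp add: affine_orbit_closure_def)
  have "(\<lambda>n. p (r n) (q (r n))) \<longlonglongrightarrow> g q'"
    by (rule bounded_gauge_moving_limit[OF p plim qlim])
  moreover have "p (r n) (q (r n)) = 1" for n
  proof -
    have "q (r n) \<notin> W (r n)" using q(1) by (simp add: W_def affine_preimage_def)
    then have "\<not> p (r n) (q (r n)) < 1" using W_eq[of "r n"] by blast
    then show ?thesis using p_le[of "r n" "q (r n)"] q(1)[of "r n"] by simp
  qed
  ultimately have gq: "g q' = 1" by (simp add: LIMSEQ_const_iff)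
  have gdisc: "g (q' + c *s w') \<le> 1" if "cmod c \<le> 1" for c
  proof (rule LIMSEQ_le_const2)
    have inv: "(\<lambda>n. 1 / real (r n + 2)) \<longlonglongrightarrow> 0"
      using LIMSEQ_subseq_LIMSEQ[OF LIMSEQ_ignore_initial_segment[OF lim_1_over_n, of 2] r]
      by (simp add: o_def)
    have "(\<lambda>n. (1 - 1 / real (r n + 2)) *\<^sub>R q (r n) + c *s w (r n)) \<longlonglongrightarrow> (1 - 0) *\<^sub>R q' + c *s w'"
      by (intro tendsto_intros inv qlim wlim)
    then have "(\<lambda>n. (1 - 1 / real (r n + 2)) *\<^sub>R q (r n) + c *s w (r n)) \<longlonglongrightarrow> q' + c *s w'" by simp
    then show "(\<lambda>n. p (r n) ((1 - 1 / real (r n + 2)) *\<^sub>R q (r n) + c *s w (r n))) \<longlonglongrightarrow> g (q' + c *s w')"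
      by (rule bounded_gauge_moving_limit[OF p plim])
    show "\<exists>N. \<forall>n\<ge>N. p (r n) ((1 - 1 / real (r n + 2)) *\<^sub>R q (r n) + c *s w (r n)) \<le> 1"
      using p_le[OF disc[OF that]] by blast
  qed
  have geq: "g (q' + c *s w') = 1" if c: "cmod c \<le> 1" for c
  proof -
    have "2 * g q' = g (2 *\<^sub>R q')" using bounded_gauge_scale[OF g, of 2 q'] by simp
    also have "2 *\<^sub>R q' = (q' + c *s w') + (q' + (- c) *s w')"
      by (simp add: vec_eq_iff scaleR_2)
    also have "g \<dots> \<le> g (q' + c *s w') + g (q' + (- c) *s w')" by (rule bounded_gauge_add[OF g])
    finally show ?thesis using gdisc[OF c] gdisc[of "- c"] c gq by simp
  qed
  have "holomorphic_disc_into (\<lambda>z. q' + z *s w') (frontier E)"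
    unfolding holomorphic_disc_into_def
  proof (intro conjI allI)
    show "(\<lambda>z. (q' + z *s w') $ i) holomorphic_on ball 0 1" for i
      by (auto intro!: holomorphic_intros)
    have "interior E = E" using bounded_gauge_open[OF g] by (simp add: E_def interior_open)
    then have "frontier E = {z. g z = 1}" unfolding frontier_def clE by (auto simp: E_def)
    then show "(\<lambda>z. q' + z *s w') ` ball 0 1 \<subseteq> frontier E" using geq by auto
  qed
  then have "(\<lambda>z. q' + z *s w') constant_on ball 0 1"
    using \<open>simple_boundary E\<close> unfolding simple_boundary_def by blast
  then obtain k where k: "\<And>z. z \<in> ball 0 1 \<Longrightarrow> q' + z *s w' = k" unfolding constant_on_def by blast
  have "q' + 0 *s w' = q' + (1 / 2) *s w'"
    using k[of 0] k[of "1 / 2"] by simp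
  then have "w' = 0" by (simp add: vec_eq_iff)
  moreover have "e \<le> norm w'"
    by (rule LIMSEQ_le_const[OF tendsto_norm[OF wlim]]) (use w(1) in blast)
  ultimately show False using w(2) by simp
qed

lemma segment_in_domain:
  assumes "C_properly_convex_domain \<Omega>" "o' \<in> \<Omega>" "q \<in> closure \<Omega>" "0 < t" "t \<le> 1"
  shows "q + t *\<^sub>R (o' - q) \<in> \<Omega>"
  using convex_shrink_open[OF C_properly_convex_domainD(2,1)[OF assms(1)] assms(2), of "q - o'" "1 - t"] assms
  by (simp add: algebra_simps)

lemma disc_dirs_doubling:
  fixes \<Omega> :: "(complex ^ 'd) set"
  assumes \<Omega>: "C_properly_convex_domain \<Omega>"
    and simple: "\<And>D. D \<in> affine_orbit_closure \<Omega> \<Longrightarrow> simple_boundary D"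
    and o: "cball o' \<rho> \<subseteq> \<Omega>" "0 < \<rho>"
  shows "\<exists>N\<ge>2. \<forall>q s v. q \<in> closure \<Omega> - \<Omega> \<and> norm q \<le> R \<and> 0 < s \<and> real N * s \<le> 1 / 2 \<and>
    v \<in> disc_dirs \<Omega> (q + s *\<^sub>R (o' - q)) \<longrightarrow> 2 *\<^sub>R v \<in> disc_dirs \<Omega> (q + (real N * s) *\<^sub>R (o' - q))"
proof (rule ccontr)
  assume "\<not> ?thesis"
  then have "\<exists>q s v. q \<in> closure \<Omega> - \<Omega> \<and> norm q \<le> R \<and> 0 < s \<and> real (n + 2) * s \<le> 1 / 2 \<and>
    v \<in> disc_dirs \<Omega> (q + s *\<^sub>R (o' - q)) \<and> 2 *\<^sub>R v \<notin> disc_dirs \<Omega> (q + (real (n + 2) * s) *\<^sub>R (o' - q))" for n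
    by (metis le_add2)
  then obtain q s v where q: "\<And>n. q n \<in> closure \<Omega> - \<Omega>" "\<And>n. norm (q n) \<le> R"
    and s: "\<And>n. 0 < s n" "\<And>n. real (n + 2) * s n \<le> 1 / 2"
    and v: "\<And>n. v n \<in> disc_dirs \<Omega> (q n + s n *\<^sub>R (o' - q n))"
      "\<And>n. 2 *\<^sub>R v n \<notin> disc_dirs \<Omega> (q n + (real (n + 2) * s n) *\<^sub>R (o' - q n))"
    by metis
  note D = C_properly_convex_domainD[OF \<Omega>]
  have o': "o' \<in> \<Omega>" using o by auto
  define t where "t n = real (n + 2) * s n" for n
  have t: "0 < t n" "t n \<le> 1 / 2" "s n < t n" for n
  proof -
    show "t n \<le> 1 / 2" using s by (simp add: t_def)
    show "0 < t n" using s(1)[of n] by (simp add: t_def)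
    show "s n < t n" unfolding t_def using mult_strict_right_mono[of 1 "real (n + 2)" "s n"] s(1)[of n] by simp
  qed
  define y where "y n = q n + t n *\<^sub>R (o' - q n)" for n
  have y: "y n \<in> \<Omega>" for n
    unfolding y_def by (rule segment_in_domain[OF \<Omega> o']) (use q t[of n] in auto)
  let ?d = "real CARD('d)"
  have "\<exists>M :: complex ^ 'd ^ 'd. invertible M \<and> (\<forall>z. norm z \<le> 1 / ?d \<longrightarrow> y n + M *v z \<in> closure \<Omega>) \<and>
    (\<forall>v\<in>disc_dirs \<Omega> (y n). \<exists>z. v = M *v z \<and> (\<forall>i. cmod (z $ i) \<le> 1))" for n
    using affine_normalisation[OF \<Omega> y[of n]] by metis
  then obtain M :: "nat \<Rightarrow> complex ^ 'd ^ 'd" where M: "\<And>n. invertible (M n)"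
    "\<And>n z. norm z \<le> 1 / ?d \<Longrightarrow> y n + M n *v z \<in> closure \<Omega>"
    "\<And>n v. v \<in> disc_dirs \<Omega> (y n) \<Longrightarrow> \<exists>z. v = M n *v z \<and> (\<forall>i. cmod (z $ i) \<le> 1)"
    by metis
  define B where "B = norm o' + R + 1"
  have B: "norm (o' - q n) \<le> B" "0 < B" for n
    using norm_triangle_ineq4[of o' "q n"] q(2)[of n] norm_ge_zero[of o'] norm_ge_zero[of "q n"]
    unfolding B_def by linarith+
  have "\<exists>z. (t n * \<rho> / B) *\<^sub>R (o' - q n) = M n *v z \<and> (\<forall>i. cmod (z $ i) \<le> 1)" for n
  proof (rule M(3))
    show "(t n * \<rho> / B) *\<^sub>R (o' - q n) \<in> disc_dirs \<Omega> (y n)"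
      unfolding disc_dirs_def
    proof (intro CollectI allI impI)
      fix c :: complex assume c: "cmod c \<le> 1"
      define u where "u = (complex_of_real (\<rho> / B) * c) *s (o' - q n)"
      have "norm u = cmod c * (\<rho> * (norm (o' - q n) / B))"
        unfolding u_def norm_vector_smult using o(2) B(2) by (simp add: norm_mult norm_divide)
      also have "\<dots> \<le> 1 * (\<rho> * 1)"
        using c B o(2) by (intro mult_mono) auto
      finally have "o' + u \<in> cball o' \<rho>" by (simp add: dist_norm)
      then have "o' + u \<in> closure \<Omega>" using o(1) closure_subset by blast
      then have "(1 - t n) *\<^sub>R q n + t n *\<^sub>R (o' + u) \<in> closure \<Omega>"
        using q t[of n] D(2) by (intro convexD[OF convex_closure]) auto
      also have "(1 - t n) *\<^sub>R q n + t n *\<^sub>R (o' + u) = y n + c *s ((t n * \<rho> / B) *\<^sub>R (o' - q n))"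
        by (simp add: u_def y_def vec_eq_iff scaleR_conv_of_real[where 'a = complex] algebra_simps)
      finally show "y n + c *s ((t n * \<rho> / B) *\<^sub>R (o' - q n)) \<in> closure \<Omega>" .
    qed
  qed
  then obtain z :: "nat \<Rightarrow> complex ^ 'd" where z: "\<And>n. (t n * \<rho> / B) *\<^sub>R (o' - q n) = M n *v z n" "\<And>n i. cmod (z n $ i) \<le> 1"
    by metis
  define q' where "q' n = (- (B / \<rho>)) *\<^sub>R z n" for n
  have q': "y n + M n *v q' n = q n" for n
  proof -
    have "M n *v q' n = (- (B / \<rho>)) *\<^sub>R ((t n * \<rho> / B) *\<^sub>R (o' - q n))"
      unfolding q'_def matrix_vector_mult_scaleR_right z(1) ..
    then show ?thesis using B(2) o(2) by (simp add: y_def)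
  qed
  have "\<exists>z. (1 / 2) *\<^sub>R v n = M n *v z \<and> (\<forall>i. cmod (z $ i) \<le> 1)" for n
  proof (rule M(3))
    define \<mu> where "\<mu> = (t n - s n) / (1 - s n)"
    have \<mu>: "0 \<le> \<mu>" "\<mu> \<le> 1 / 2" using t[of n] s(1)[of n] by (simp_all add: \<mu>_def divide_simps)
    have eq: "(1 - \<mu>) * (1 - s n) = 1 - t n" using t[of n] by (simp add: \<mu>_def field_simps)
    have "(1 - \<mu>) *\<^sub>R v n \<in> disc_dirs \<Omega> ((1 - \<mu>) *\<^sub>R (q n + s n *\<^sub>R (o' - q n)) + \<mu> *\<^sub>R o')"
      by (rule disc_dirs_convex_combination[OF D(2) _ v(1)]) (use o' closure_subset \<mu> in auto)
    also have "(1 - \<mu>) *\<^sub>R (q n + s n *\<^sub>R (o' - q n)) + \<mu> *\<^sub>R o' =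
      ((1 - \<mu>) * (1 - s n)) *\<^sub>R q n + (1 - (1 - \<mu>) * (1 - s n)) *\<^sub>R o'"
      by (simp add: algebra_simps)
    also have "\<dots> = y n" unfolding eq by (simp add: y_def algebra_simps)
    finally have "complex_of_real (1 / (2 * (1 - \<mu>))) *s ((1 - \<mu>) *\<^sub>R v n) \<in> disc_dirs \<Omega> (y n)"
    proof (rule disc_dirs_scale)
      have "\<bar>1 / (2 * (1 - \<mu>))\<bar> \<le> 1" using \<mu> by simp
      then show "cmod (complex_of_real (1 / (2 * (1 - \<mu>)))) \<le> 1" by (simp only: norm_of_real)
    qed
    then have "(1 / (2 * (1 - \<mu>)) * (1 - \<mu>)) *\<^sub>R v n \<in> disc_dirs \<Omega> (y n)"
      by (simp only: scaleR_eq_vector_smult[of "1 / (2 * (1 - \<mu>))", symmetric] scaleR_scaleR)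
    moreover have "1 / (2 * (1 - \<mu>)) * (1 - \<mu>) = 1 / 2" using \<mu> by (simp add: field_simps)
    ultimately show "(1 / 2) *\<^sub>R v n \<in> disc_dirs \<Omega> (y n)" by (simp only:)
  qed
  then obtain u :: "nat \<Rightarrow> complex ^ 'd" where u: "\<And>n. (1 / 2) *\<^sub>R v n = M n *v u n" "\<And>n i. cmod (u n $ i) \<le> 1"
    by metis
  define w where "w n = 2 *\<^sub>R u n" for n
  have w: "M n *v w n = v n" for n
    by (simp add: w_def matrix_vector_mult_scaleR_right u(1)[symmetric])
  show False
  proof (rule scaling_limit[OF \<Omega> simple y M])
    show "y n + M n *v q' n \<in> closure \<Omega> - \<Omega>" for n using q' q by simp
    have "norm (q' n) \<le> (B / \<rho>) * (?d * 1)" for n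
      unfolding q'_def using norm_le_card_complex_vec[OF z(2), of n] B(2) o(2)
      by (simp add: mult_left_mono divide_right_mono)
    then show "bounded (range q')" unfolding bounded_iff by blast
    have "norm (w n) \<le> 2 * (?d * 1)" for n
      unfolding w_def using norm_le_card_complex_vec[OF u(2), of n] by simp
    then show "bounded (range w)" unfolding bounded_iff by blast
    show "1 / (2 * ?d) \<le> norm (w n)" for n
    proof (rule ccontr)
      assume less: "\<not> 1 / (2 * ?d) \<le> norm (w n)"
      have "2 *\<^sub>R v n \<in> disc_dirs \<Omega> (y n)"
        unfolding disc_dirs_def
      proof (intro CollectI allI impI)
        fix c :: complex assume c: "cmod c \<le> 1"
        have "norm ((2 * c) *s w n) = 2 * (cmod c * norm (w n))" by (simp add: norm_vector_smult norm_mult)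
        also have "\<dots> \<le> 2 * (1 * (1 / (2 * ?d)))"
          using c less by (intro mult_left_mono mult_mono) auto
        finally have "y n + M n *v ((2 * c) *s w n) \<in> closure \<Omega>" by (intro M(2)) simp
        then show "y n + c *s (2 *\<^sub>R v n) \<in> closure \<Omega>"
          by (simp add: vec.scale w scaleR_eq_vector_smult vector_smult_assoc mult.commute)
      qed
      then show False using v(2)[of n] by (simp add: y_def t_def)
    qed
    show "(0 :: real) < 1 / (2 * ?d)" by simp
    show "y n + M n *v ((1 - 1 / real (n + 2)) *\<^sub>R q' n + c *s w n) \<in> closure \<Omega>" if "cmod c \<le> 1" for n c
    proof -
      have Mq: "M n *v q' n = q n - y n" using q'[of n] by (simp add: algebra_simps)
      have "(1 - 1 / real (n + 2)) * t n = t n - s n"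
        unfolding t_def by (simp add: field_simps)
      then have "y n + (1 - 1 / real (n + 2)) *\<^sub>R (q n - y n) = q n + s n *\<^sub>R (o' - q n)"
        by (simp add: y_def scaleR_left_diff_distrib[symmetric] diff_diff_eq)
      then have "y n + M n *v ((1 - 1 / real (n + 2)) *\<^sub>R q' n + c *s w n) = (q n + s n *\<^sub>R (o' - q n)) + c *s v n"
        by (simp add: matrix_vector_right_distrib matrix_vector_mult_scaleR_right vec.scale Mq w)
      then show ?thesis using disc_dirsD[OF v(1) that] by simp
    qed
  qed
qed

section \<open>Lower bounds for the Kobayashi distance\<close>

lemma exp_2_artanh:
  assumes "0 \<le> x" "x < 1"
  shows "exp (2 * artanh (x::real)) = (1 + x) / (1 - x)"
  using assms by (simp add: artanh_def exp_ln)

lemma poincare_ratio_less_1: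
  assumes "z \<in> ball 0 1" "w \<in> ball 0 1"
  shows "cmod ((z - w) / (1 - cnj w * z)) < 1"
  using Moebius_function_norm_lt_1[of w z 0] assms by (simp add: Moebius_function_simple)

lemma poincare_dist_nonneg:
  assumes "z \<in> ball 0 1" "w \<in> ball 0 1"
  shows "0 \<le> poincare_dist z w"
  unfolding poincare_dist_def artanh_def using poincare_ratio_less_1[OF assms]
  by (simp add: field_simps)

lemma Schwarz_Pick_half_plane:
  assumes g: "g holomorphic_on ball 0 1" "\<And>z. z \<in> ball 0 1 \<Longrightarrow> 0 < Re (g z)"
    and s: "s \<in> ball 0 1" and t: "t \<in> ball 0 1"
  shows "cmod (g t - g s) \<le> Re (g s) * (exp (2 * poincare_dist s t) - 1)"
proof -
  let ?\<phi> = "Moebius_function 0 (- s)"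
  define x where "x = Moebius_function 0 s t"
  have s1: "cmod s < 1" and t1: "cmod t < 1" using s t by auto
  have nz: "g z + cnj (g s) \<noteq> 0" if "z \<in> ball 0 1" for z
    using g(2)[OF that] g(2)[OF s] by (metis add_pos_pos cnj.simps(1) less_irrefl plus_complex.simps(1) zero_complex.simps(1))
  define h where "h z = (g z - g s) / (g z + cnj (g s))" for z
  have h_lt: "cmod (h z) < 1" if "z \<in> ball 0 1" for z
  proof -
    have "(cmod (g z - g s))\<^sup>2 < (cmod (g z + cnj (g s)))\<^sup>2"
      using mult_pos_pos[OF g(2)[OF that] g(2)[OF s]]
      by (simp add: cmod_power2) (simp add: power2_eq_square algebra_simps)
    then have "cmod (g z - g s) < cmod (g z + cnj (g s))" by (rule power_less_imp_less_base) simp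
    then show ?thesis using nz[OF that] by (simp add: h_def norm_divide)
  qed
  have h: "h holomorphic_on ball 0 1"
    unfolding h_def using nz by (intro holomorphic_intros g(1)) auto
  have \<phi>: "?\<phi> holomorphic_on ball 0 1" "?\<phi> ` ball 0 1 \<subseteq> ball 0 1"
    using Moebius_function_holomorphic[of "- s" 0] Moebius_function_norm_lt_1[of "- s"] s1 by auto
  have "(h \<circ> ?\<phi>) holomorphic_on ball 0 1"
    by (rule holomorphic_on_compose_gen[OF \<phi>(1) h \<phi>(2)])
  moreover have "(h \<circ> ?\<phi>) 0 = 0" by (simp add: h_def Moebius_function_of_zero)
  moreover have "cmod ((h \<circ> ?\<phi>) z) < 1" if "cmod z < 1" for z
    using h_lt \<phi>(2) that by (auto simp: image_subset_iff)
  moreover have x1: "cmod x < 1" unfolding x_def by (rule Moebius_function_norm_lt_1[OF s1 t1])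
  ultimately have "cmod ((h \<circ> ?\<phi>) x) \<le> cmod x" by (rule Schwarz_Lemma(1))
  moreover have "?\<phi> x = t"
    unfolding x_def by (rule Moebius_function_compose) (use s1 t1 in auto)
  ultimately have "cmod (g t - g s) \<le> cmod x * cmod (g t + cnj (g s))"
    using nz[OF t] by (simp add: h_def norm_divide field_simps)
  also have "cmod (g t + cnj (g s)) \<le> cmod (g t - g s) + 2 * Re (g s)"
  proof -
    have "g t + cnj (g s) = (g t - g s) + (g s + cnj (g s))" by simp
    also have "cmod \<dots> \<le> cmod (g t - g s) + cmod (g s + cnj (g s))" by (rule norm_triangle_ineq)
    also have "cmod (g s + cnj (g s)) = 2 * Re (g s)"
      using g(2)[OF s] by (simp add: complex_add_cnj del: of_real_mult)
    finally show ?thesis .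
  qed
  finally have "cmod (g t - g s) \<le> cmod x * (cmod (g t - g s) + 2 * Re (g s))"
    by (simp add: mult_left_mono)
  then have "cmod (g t - g s) * (1 - cmod x) \<le> Re (g s) * (2 * cmod x)"
    by (simp add: algebra_simps)
  then have "cmod (g t - g s) \<le> Re (g s) * (2 * cmod x / (1 - cmod x))"
    using x1 by (simp add: field_simps)
  also have "2 * cmod x / (1 - cmod x) = exp (2 * artanh (cmod x)) - 1"
    using x1 by (simp add: exp_2_artanh field_simps)
  also have "artanh (cmod x) = poincare_dist s t"
  proof -
    have "cmod (1 - cnj s * t) = cmod (cnj (1 - cnj s * t))" by (simp only: complex_mod_cnj)
    then have "cmod (1 - cnj s * t) = cmod (1 - cnj t * s)" by (simp add: mult.commute)
    then show ?thesis
      by (simp add: poincare_dist_def x_def Moebius_function_simple norm_divide norm_minus_commute)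
  qed
  finally show ?thesis .
qed

lemma disc_chain_half_plane:
  fixes F :: "complex ^ 'd \<Rightarrow> complex"
  assumes F: "\<And>f. holomorphic_disc_into f \<Omega> \<Longrightarrow> (\<lambda>z. F (f z)) holomorphic_on ball 0 1"
    and pos: "\<And>z. z \<in> \<Omega> \<Longrightarrow> 0 < Re (F z)"
    and l: "l \<in> disc_chain_lengths \<Omega> x y"
  shows "cmod (F y - F x) \<le> Re (F x) * (exp (2 * l) - 1)"
proof -
  obtain n f s t where l_eq: "l = (\<Sum>k\<le>n. poincare_dist (s k) (t k))"
    and disc: "\<And>k. k \<le> n \<Longrightarrow> holomorphic_disc_into (f k) \<Omega> \<and> s k \<in> ball 0 1 \<and> t k \<in> ball 0 1"
    and ends: "f 0 (s 0) = x" "f n (t n) = y"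
    and link: "\<And>k. k < n \<Longrightarrow> f k (t k) = f (Suc k) (s (Suc k))"
    using l unfolding disc_chain_lengths_def by blast
  let ?L = "\<lambda>m. \<Sum>k\<le>m. poincare_dist (s k) (t k)"
  have step: "cmod (F (f k (t k)) - F (f k (s k))) \<le> Re (F (f k (s k))) * (exp (2 * poincare_dist (s k) (t k)) - 1)"
    if "k \<le> n" for k
    using disc[OF that] by (intro Schwarz_Pick_half_plane F pos) (auto simp: holomorphic_disc_into_def)
  have "cmod (F (f m (t m)) - F x) \<le> Re (F x) * (exp (2 * ?L m) - 1)" if "m \<le> n" for m
    using that
  proof (induction m)
    case 0
    then show ?case using step[of 0] by (simp add: ends)
  next
    case (Suc m)
    let ?u = "F (f m (t m))" and ?e = "exp (2 * poincare_dist (s (Suc m)) (t (Suc m)))"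
    have IH: "cmod (?u - F x) \<le> Re (F x) * (exp (2 * ?L m) - 1)" using Suc by simp
    have "Re ?u \<le> Re (F x) + cmod (?u - F x)" using complex_Re_le_cmod[of "?u - F x"] by simp
    then have u: "Re ?u \<le> Re (F x) * exp (2 * ?L m)" using IH by (simp add: algebra_simps)
    have "0 \<le> poincare_dist (s (Suc m)) (t (Suc m))"
      using poincare_dist_nonneg disc[OF Suc.prems] by blast
    then have e: "1 \<le> ?e" by simp
    have "cmod (F (f (Suc m) (t (Suc m))) - F x) \<le> cmod (F (f (Suc m) (t (Suc m))) - ?u) + cmod (?u - F x)"
      using norm_triangle_ineq[of "F (f (Suc m) (t (Suc m))) - ?u" "?u - F x"] by simp
    also have "\<dots> \<le> Re ?u * (?e - 1) + Re (F x) * (exp (2 * ?L m) - 1)"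
      using step[OF Suc.prems] link[of m] Suc.prems IH by (intro add_mono) auto
    also have "\<dots> \<le> Re (F x) * exp (2 * ?L m) * (?e - 1) + Re (F x) * (exp (2 * ?L m) - 1)"
      using u e by (intro add_right_mono mult_right_mono) auto
    also have "\<dots> = Re (F x) * (exp (2 * ?L (Suc m)) - 1)"
      by (simp add: distrib_left exp_add algebra_simps)
    finally show ?case .
  qed
  from this[of n] show ?thesis by (simp add: ends l_eq)
qed

lemma disc_chain_lengths_nonneg: "l \<in> disc_chain_lengths \<Omega> x y \<Longrightarrow> 0 \<le> l"
  unfolding disc_chain_lengths_def by (auto intro!: sum_nonneg poincare_dist_nonneg)

lemma kobayashi_dist_le:
  "l \<in> disc_chain_lengths \<Omega> x y \<Longrightarrow> kobayashi_dist \<Omega> x y \<le> l"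
  unfolding kobayashi_dist_def
  by (rule cInf_lower) (auto intro!: bdd_belowI[of _ 0] disc_chain_lengths_nonneg)

text \<open>A point \<open>x + c m (y - x)\<close> outside the closure is separated from \<open>\<Omega>\<close> by a real hyperplane,
  and the associated complex functional maps \<open>\<Omega>\<close> into a half plane.\<close>

lemma disc_dirs_of_kobayashi_dist:
  fixes \<Omega> :: "(complex ^ 'd) set"
  assumes \<Omega>: "C_properly_convex_domain \<Omega>" and x: "x \<in> \<Omega>"
    and ne: "disc_chain_lengths \<Omega> x y \<noteq> {}"
    and m: "0 < m" "m * (exp (2 * kobayashi_dist \<Omega> x y) - 1) < 1"
  shows "m *\<^sub>R (y - x) \<in> disc_dirs \<Omega> x"
proof (rule ccontr)
  assume "m *\<^sub>R (y - x) \<notin> disc_dirs \<Omega> x"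
  then obtain c where c: "cmod c \<le> 1" "x + c *s (m *\<^sub>R (y - x)) \<notin> closure \<Omega>"
    unfolding disc_dirs_def by blast
  note D = C_properly_convex_domainD[OF \<Omega>]
  define p where "p = x + c *s (m *\<^sub>R (y - x))"
  have c0: "c \<noteq> 0" using c(2) x closure_subset by fastforce
  obtain a b where ab: "a \<bullet> p < b" "\<And>z. z \<in> closure \<Omega> \<Longrightarrow> b < a \<bullet> z"
    using separating_hyperplane_closed_point[OF convex_closure[OF D(2)] closed_closure c(2)[folded p_def]] by blast
  define F where "F z = (\<Sum>i\<in>UNIV. cnj (a $ i) * (z $ i - p $ i))" for z
  have ReF: "Re (F z) = a \<bullet> (z - p)" for z
    by (simp add: F_def inner_vec_def inner_complex_def)
  have pos: "0 < Re (F z)" if "z \<in> \<Omega>" for z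
    using ab(1) ab(2)[of z] that closure_subset[of \<Omega>] unfolding ReF inner_diff_right by fastforce
  define \<alpha> where "\<alpha> = (\<Sum>i\<in>UNIV. cnj (a $ i) * (y $ i - x $ i))"
  have diff: "F y - F x = \<alpha>"
    by (simp add: F_def \<alpha>_def sum_subtractf[symmetric] right_diff_distrib[symmetric])
  have Fx: "F x = - (c * complex_of_real m * \<alpha>)"
    by (simp add: F_def p_def \<alpha>_def scaleR_conv_of_real[where 'a = complex] sum_distrib_left sum_negf[symmetric] algebra_simps)
  have bound: "cmod \<alpha> \<le> Re (F x) * (exp (2 * l) - 1)" if "l \<in> disc_chain_lengths \<Omega> x y" for l
    unfolding diff[symmetric]
  proof (rule disc_chain_half_plane[OF _ pos that])
    show "(\<lambda>z. F (f z)) holomorphic_on ball 0 1" if "holomorphic_disc_into f \<Omega>" for f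
      unfolding F_def using that unfolding holomorphic_disc_into_def
      by (intro holomorphic_intros) auto
  qed
  have "(1 / m + 1) \<le> exp (2 * l)" if "l \<in> disc_chain_lengths \<Omega> x y" for l
  proof -
    have "0 < Re (F x)" by (rule pos[OF x])
    then have \<alpha>: "0 < cmod \<alpha>" using Fx by auto
    have l0: "0 \<le> exp (2 * l) - 1" using disc_chain_lengths_nonneg[OF that] by simp
    have "Re (F x) \<le> cmod c * m * cmod \<alpha>"
      using complex_Re_le_cmod[of "F x"] m(1) by (simp add: Fx norm_mult)
    also have "\<dots> \<le> 1 * m * cmod \<alpha>" using c(1) m(1) by (intro mult_right_mono) auto
    finally have "Re (F x) * (exp (2 * l) - 1) \<le> m * cmod \<alpha> * (exp (2 * l) - 1)"
      using l0 by (intro mult_right_mono) auto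
    then have "cmod \<alpha> * 1 \<le> cmod \<alpha> * (m * (exp (2 * l) - 1))"
      using bound[OF that] by (simp add: algebra_simps)
    then have "1 \<le> m * (exp (2 * l) - 1)" using \<alpha> by (simp only: mult_le_cancel_left_pos)
    then show ?thesis using m(1) by (simp add: field_simps)
  qed
  then have "ln (1 / m + 1) \<le> ln (exp (2 * l))" if "l \<in> disc_chain_lengths \<Omega> x y" for l
    using that m(1) by (subst ln_le_cancel_iff) (auto simp: add_pos_pos)
  then have "ln (1 / m + 1) / 2 \<le> l" if "l \<in> disc_chain_lengths \<Omega> x y" for l
    using that by fastforce
  then have "ln (1 / m + 1) / 2 \<le> kobayashi_dist \<Omega> x y"
    unfolding kobayashi_dist_def using ne by (intro cInf_greatest)
  then have "ln (1 / m + 1) \<le> 2 * kobayashi_dist \<Omega> x y" by simp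
  then have "exp (ln (1 / m + 1)) \<le> exp (2 * kobayashi_dist \<Omega> x y)" by (simp only: exp_le_cancel_iff)
  then have "1 / m + 1 \<le> exp (2 * kobayashi_dist \<Omega> x y)" using m(1) by (simp add: add_pos_pos)
  then show False using m by (simp add: field_simps)
qed

lemma disc_chain_lengths_trans:
  assumes "l \<in> disc_chain_lengths \<Omega> x y" "l' \<in> disc_chain_lengths \<Omega> y z"
  shows "l + l' \<in> disc_chain_lengths \<Omega> x z"
proof -
  obtain n f s t where 1: "l = (\<Sum>k\<le>n. poincare_dist (s k) (t k))"
    "\<And>k. k \<le> n \<Longrightarrow> holomorphic_disc_into (f k) \<Omega> \<and> s k \<in> ball 0 1 \<and> t k \<in> ball 0 1"
    "f 0 (s 0) = x" "f n (t n) = y" "\<And>k. k < n \<Longrightarrow> f k (t k) = f (Suc k) (s (Suc k))"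
    using assms(1) unfolding disc_chain_lengths_def by blast
  obtain n' f' s' t' where 2: "l' = (\<Sum>k\<le>n'. poincare_dist (s' k) (t' k))"
    "\<And>k. k \<le> n' \<Longrightarrow> holomorphic_disc_into (f' k) \<Omega> \<and> s' k \<in> ball 0 1 \<and> t' k \<in> ball 0 1"
    "f' 0 (s' 0) = y" "f' n' (t' n') = z" "\<And>k. k < n' \<Longrightarrow> f' k (t' k) = f' (Suc k) (s' (Suc k))"
    using assms(2) unfolding disc_chain_lengths_def by blast
  define N where "N = n + n' + 1"
  define F where "F k = (if k \<le> n then f k else f' (k - Suc n))" for k
  define S where "S k = (if k \<le> n then s k else s' (k - Suc n))" for k
  define T where "T k = (if k \<le> n then t k else t' (k - Suc n))" for k
  have "l + l' = (\<Sum>k\<le>N. poincare_dist (S k) (T k))"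
  proof -
    have "{..N} = {..n} \<union> (\<lambda>k. k + Suc n) ` {..n'}"
    proof (intro equalityI subsetI)
      fix k assume "k \<in> {..N}"
      then show "k \<in> {..n} \<union> (\<lambda>k. k + Suc n) ` {..n'}"
        by (cases "k \<le> n") (auto simp: N_def intro!: image_eqI[of _ _ "k - Suc n"])
    qed (auto simp: N_def)
    moreover have "{..n} \<inter> (\<lambda>k. k + Suc n) ` {..n'} = {}" by auto
    ultimately have "(\<Sum>k\<le>N. poincare_dist (S k) (T k)) =
      (\<Sum>k\<le>n. poincare_dist (S k) (T k)) + (\<Sum>k\<in>(\<lambda>k. k + Suc n) ` {..n'}. poincare_dist (S k) (T k))"
      by (simp add: sum.union_disjoint)
    also have "(\<Sum>k\<in>(\<lambda>k. k + Suc n) ` {..n'}. poincare_dist (S k) (T k)) = l'"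
      unfolding 2(1) by (subst sum.reindex) (auto simp: inj_on_def S_def T_def)
    also have "(\<Sum>k\<le>n. poincare_dist (S k) (T k)) = l" unfolding 1(1) by (simp add: S_def T_def)
    finally show ?thesis by simp
  qed
  moreover have "\<forall>k\<le>N. holomorphic_disc_into (F k) \<Omega> \<and> S k \<in> ball 0 1 \<and> T k \<in> ball 0 1"
  proof (intro allI impI)
    fix k assume "k \<le> N"
    then show "holomorphic_disc_into (F k) \<Omega> \<and> S k \<in> ball 0 1 \<and> T k \<in> ball 0 1"
      using 1(2)[of k] 2(2)[of "k - Suc n"] by (cases "k \<le> n") (simp_all add: F_def S_def T_def N_def)
  qed
  moreover have "F 0 (S 0) = x" "F N (T N) = z"
    using 1(3) 2(4) by (simp_all add: F_def S_def T_def N_def)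
  moreover have "\<forall>k<N. F k (T k) = F (Suc k) (S (Suc k))"
  proof (intro allI impI)
    fix k assume k: "k < N"
    consider "k < n" | "k = n" | "n < k" by linarith
    then show "F k (T k) = F (Suc k) (S (Suc k))"
    proof cases
      case 1
      then show ?thesis using \<open>\<And>k. k < n \<Longrightarrow> f k (t k) = f (Suc k) (s (Suc k))\<close>[of k]
        by (simp add: F_def S_def T_def)
    next
      case 2
      then show ?thesis using \<open>f n (t n) = y\<close> \<open>f' 0 (s' 0) = y\<close> by (simp add: F_def S_def T_def)
    next
      case 3
      then have "k - Suc n < n'" "Suc k - Suc n = Suc (k - Suc n)" using k by (auto simp: N_def)
      then show ?thesis using \<open>\<And>k. k < n' \<Longrightarrow> f' k (t' k) = f' (Suc k) (s' (Suc k))\<close>[of "k - Suc n"] 3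
        by (simp add: F_def S_def T_def)
    qed
  qed
  ultimately show ?thesis unfolding disc_chain_lengths_def by blast
qed

lemma disc_chain_lengths_single:
  assumes "holomorphic_disc_into f \<Omega>" "s \<in> ball 0 1" "t \<in> ball 0 1"
  shows "poincare_dist s t \<in> disc_chain_lengths \<Omega> (f s) (f t)"
  unfolding disc_chain_lengths_def
  by (rule CollectI, rule exI[of _ 0], rule exI[of _ "\<lambda>_. f"], rule exI[of _ "\<lambda>_. s"],
      rule exI[of _ "\<lambda>_. t"]) (use assms in auto)

lemma disc_chain_lengths_near:
  fixes x :: "complex ^ 'd"
  assumes "ball x e \<subseteq> \<Omega>" "2 * norm (y - x) \<le> e" "0 < e"
  shows "artanh (1 / 2) \<in> disc_chain_lengths \<Omega> x y" "artanh (1 / 2) \<in> disc_chain_lengths \<Omega> y x"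
proof -
  define f where "f z = x + (2 * z) *s (y - x)" for z
  have disc: "holomorphic_disc_into f \<Omega>"
    unfolding holomorphic_disc_into_def
  proof (intro conjI allI)
    show "(\<lambda>z. f z $ i) holomorphic_on ball 0 1" for i
      unfolding f_def by (auto intro!: holomorphic_intros)
    have "f z \<in> ball x e" if z: "z \<in> ball 0 1" for z
    proof (cases "y = x")
      case False
      have "norm ((2 * z) *s (y - x)) = cmod z * (2 * norm (y - x))"
        unfolding norm_vector_smult by (simp add: norm_mult)
      also have "\<dots> < 1 * (2 * norm (y - x))"
        using z False by (intro mult_strict_right_mono) auto
      also have "\<dots> \<le> e" using assms(2) by simp
      finally have "dist (f z) x < e" unfolding dist_norm f_def add_diff_cancel_left' .
      then show ?thesis by (simp add: dist_commute)
    qed (use assms(3) in \<open>simp add: f_def\<close>)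
    then show "f ` ball 0 1 \<subseteq> \<Omega>" using assms(1) by blast
  qed
  have f: "f 0 = x" "f (1 / 2) = y" by (simp_all add: f_def)
  have "poincare_dist 0 (1 / 2) = artanh (1 / 2)" "poincare_dist (1 / 2) 0 = artanh (1 / 2)"
    by (simp_all add: poincare_dist_def)
  then show "artanh (1 / 2) \<in> disc_chain_lengths \<Omega> x y" "artanh (1 / 2) \<in> disc_chain_lengths \<Omega> y x"
    using disc_chain_lengths_single[OF disc, of 0 "1 / 2"] disc_chain_lengths_single[OF disc, of "1 / 2" 0]
    by (simp_all add: f)
qed

section \<open>Upper bounds for the Kobayashi distance and the power estimate\<close>

lemma C_properly_convex_domain_compl:
  assumes "C_properly_convex_domain \<Omega>"
  shows "closed (- \<Omega>)" "- \<Omega> \<noteq> {}"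
proof -
  show "closed (- \<Omega>)" using C_properly_convex_domainD(1)[OF assms] by (simp add: closed_Compl)
  have "(\<chi> i. 1) \<noteq> (0 :: complex ^ 'a)" by (simp add: vec_eq_iff)
  from C_properly_convex_domainD(4)[OF assms this] show "- \<Omega> \<noteq> {}" by blast
qed

lemma infdist_compl_pos:
  assumes "C_properly_convex_domain \<Omega>" "x \<in> \<Omega>"
  shows "0 < infdist x (- \<Omega>)"
  by (rule infdist_pos_not_in_closed) (use C_properly_convex_domain_compl[OF assms(1)] assms(2) in auto)

lemma ball_infdist_compl: "ball x (infdist x (- \<Omega>)) \<subseteq> \<Omega>"
proof
  fix y assume y: "y \<in> ball x (infdist x (- \<Omega>))"
  show "y \<in> \<Omega>"
  proof (rule ccontr)
    assume "y \<notin> \<Omega>"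
    then have "infdist x (- \<Omega>) \<le> dist x y" by (intro infdist_le) auto
    then show False using y by simp
  qed
qed

lemma disc_chain_lengths_from_centre:
  fixes \<Omega> :: "(complex ^ 'd) set"
  assumes \<Omega>: "C_properly_convex_domain \<Omega>" and o: "ball o' \<rho> \<subseteq> \<Omega>" "0 < \<rho>"
  shows "\<exists>A>0. \<exists>B. \<forall>x\<in>\<Omega>. norm x \<le> R \<longrightarrow>
    (\<exists>l \<le> B - A * ln (infdist x (- \<Omega>)). l \<in> disc_chain_lengths \<Omega> o' x \<and> l \<in> disc_chain_lengths \<Omega> x o')"
proof -
  note D = C_properly_convex_domainD[OF \<Omega>]
  obtain p where p: "p \<notin> \<Omega>" using C_properly_convex_domain_compl(2)[OF \<Omega>] by blast
  obtain R0 where R0: "0 \<le> R0" "R \<le> R0" using abs_ge_zero abs_ge_self by blast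
  define E where "E = R0 + norm o' + \<rho> + norm p"
  have E: "\<rho> \<le> E" "0 < E" using o(2) norm_ge_zero[of o'] norm_ge_zero[of p] R0 unfolding E_def by linarith+
  define q where "q = 1 - \<rho> / (2 * E)"
  have q: "0 < q" "q < 1" "(1 - q) * E = \<rho> / 2" using E o(2) by (simp_all add: q_def field_simps)
  define \<kappa> where "\<kappa> = ln (1 / q)"
  have \<kappa>: "0 < \<kappa>" using q by (simp add: \<kappa>_def)
  define c :: real where "c = artanh (1 / 2)"
  have c: "0 < c" by (simp add: c_def artanh_def)
  have "\<exists>l \<le> (c * (ln (2 * E) / \<kappa> + 2)) - (c / \<kappa>) * ln (infdist x (- \<Omega>)).
      l \<in> disc_chain_lengths \<Omega> o' x \<and> l \<in> disc_chain_lengths \<Omega> x o'" if x: "x \<in> \<Omega>" "norm x \<le> R" for x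
  proof -
    let ?\<delta> = "infdist x (- \<Omega>)"
    have \<delta>: "0 < ?\<delta>" by (rule infdist_compl_pos[OF \<Omega> x(1)])
    have "?\<delta> \<le> dist x p" by (rule infdist_le) (use p in simp)
    also have "\<dots> \<le> norm x + norm p" unfolding dist_norm by (rule norm_triangle_ineq4)
    also have "\<dots> \<le> E + E"
    proof (rule add_mono)
      show "norm x \<le> E" using x(2) o(2) R0 norm_ge_zero[of o'] norm_ge_zero[of p] unfolding E_def by linarith
      show "norm p \<le> E" using o(2) R0 norm_ge_zero[of o'] unfolding E_def by linarith
    qed
    also have "\<dots> = 2 * E" by simp
    finally have \<delta>E: "?\<delta> \<le> 2 * E" .
    have xE: "norm (o' - x) \<le> E"
      using norm_triangle_ineq4[of o' x] x(2) o(2) R0 norm_ge_zero[of p] unfolding E_def by linarith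
    define y where "y j = x + q ^ j *\<^sub>R (o' - x)" for j
    have ball_y: "ball (y j) (q ^ j * \<rho>) \<subseteq> \<Omega>" for j
    proof
      fix z assume z: "z \<in> ball (y j) (q ^ j * \<rho>)"
      let ?u = "(1 / q ^ j) *\<^sub>R (z - y j)"
      have "norm (z - y j) < q ^ j * \<rho>" using z by (simp add: dist_norm norm_minus_commute)
      then have "norm ?u < \<rho>" unfolding norm_scaleR using q(1) by (simp add: field_simps)
      then have "o' + ?u \<in> \<Omega>" using o(1) by (auto simp: dist_norm)
      then have "(1 - q ^ j) *\<^sub>R x + q ^ j *\<^sub>R (o' + ?u) \<in> \<Omega>"
        using D(2) x(1) q by (intro convexD) (auto simp: power_le_one)
      also have "(1 - q ^ j) *\<^sub>R x + q ^ j *\<^sub>R (o' + ?u) = z"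
        using q(1) by (simp add: y_def algebra_simps)
      finally show "z \<in> \<Omega>" .
    qed
    have chain: "real j * c \<in> disc_chain_lengths \<Omega> o' (y j) \<and> real j * c \<in> disc_chain_lengths \<Omega> (y j) o'" for j
    proof (induction j)
      case 0
      have "o' \<in> \<Omega>" using o by auto
      then have "holomorphic_disc_into (\<lambda>_. o') \<Omega>" by (auto simp: holomorphic_disc_into_def)
      from disc_chain_lengths_single[OF this, of 0 0] show ?case
        by (simp add: y_def poincare_dist_def)
    next
      case (Suc j)
      have "y (Suc j) - y j = (- (q ^ j * (1 - q))) *\<^sub>R (o' - x)"
        by (simp add: y_def algebra_simps)
      then have "norm (y (Suc j) - y j) = q ^ j * (1 - q) * norm (o' - x)"
        using q by (simp add: abs_mult)
      also have "\<dots> \<le> q ^ j * (1 - q) * E" using xE q by (intro mult_left_mono) auto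
      also have "\<dots> = q ^ j * \<rho> / 2" using q(3) by simp
      finally have near: "2 * norm (y (Suc j) - y j) \<le> q ^ j * \<rho>" by simp
      have "0 < q ^ j * \<rho>" using q o(2) by simp
      from disc_chain_lengths_near[OF ball_y near this]
      have "real j * c + c \<in> disc_chain_lengths \<Omega> o' (y (Suc j))"
        "c + real j * c \<in> disc_chain_lengths \<Omega> (y (Suc j)) o'"
        using Suc disc_chain_lengths_trans unfolding c_def by blast+
      then show ?case by (simp add: algebra_simps)
    qed
    define t where "t = ln (2 * E / ?\<delta>) / \<kappa>"
    define N where "N = nat \<lceil>t\<rceil>"
    have "0 \<le> t" using \<delta>E \<delta> \<kappa> E(2) by (simp add: t_def field_simps)
    then have N: "t \<le> real N" "real N \<le> t + 1" unfolding N_def by linarith+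
    have "2 * norm (y N - x) \<le> ?\<delta>"
    proof -
      have "ln (2 * E / ?\<delta>) \<le> real N * \<kappa>" using N(1) \<kappa> by (simp add: t_def field_simps)
      then have "real N * ln q \<le> - ln (2 * E / ?\<delta>)" using q by (simp add: \<kappa>_def ln_div)
      then have "ln (q ^ N) \<le> ln (?\<delta> / (2 * E))" using q \<delta> E by (simp add: ln_realpow ln_div ln_mult)
      then have "q ^ N \<le> ?\<delta> / (2 * E)" using q \<delta> E by (subst (asm) ln_le_cancel_iff) auto
      then have "2 * (q ^ N * E) \<le> ?\<delta>" using E by (simp add: field_simps)
      moreover have "norm (y N - x) \<le> q ^ N * E" using q xE by (simp add: y_def mult_left_mono)
      ultimately show ?thesis by linarith
    qed
    from disc_chain_lengths_near[OF ball_infdist_compl this \<delta>]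
    have "real N * c + c \<in> disc_chain_lengths \<Omega> o' x" "c + real N * c \<in> disc_chain_lengths \<Omega> x o'"
      using chain[of N] disc_chain_lengths_trans unfolding c_def by blast+
    moreover have "real N * c + c \<le> (c * (ln (2 * E) / \<kappa> + 2)) - (c / \<kappa>) * ln ?\<delta>"
    proof -
      have "real N * c + c \<le> (t + 1) * c + c" using N(2) c by simp
      also have "\<dots> = (c * (ln (2 * E) / \<kappa> + 2)) - (c / \<kappa>) * ln ?\<delta>"
        using \<delta> E by (simp add: t_def ln_div algebra_simps add_divide_distrib diff_divide_distrib)
      finally show ?thesis .
    qed
    ultimately show ?thesis by (intro exI[of _ "real N * c + c"]) (simp add: add.commute)
  qed
  moreover have "0 < c / \<kappa>" using c \<kappa> by simp
  ultimately show ?thesis by blast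
qed

lemma kobayashi_dist_upper_bound:
  fixes \<Omega> :: "(complex ^ 'd) set"
  assumes \<Omega>: "C_properly_convex_domain \<Omega>"
  shows "\<exists>A>0. \<exists>B. \<forall>x\<in>\<Omega>. \<forall>y\<in>\<Omega>. norm x \<le> R \<longrightarrow> norm y \<le> R \<longrightarrow> disc_chain_lengths \<Omega> x y \<noteq> {} \<and>
    kobayashi_dist \<Omega> x y \<le> B - A * ln (infdist x (- \<Omega>)) - A * ln (infdist y (- \<Omega>))"
proof -
  obtain o' where o': "o' \<in> \<Omega>" using C_properly_convex_domainD(3)[OF \<Omega>] by blast
  obtain A B where A: "0 < A" and B: "\<And>x. x \<in> \<Omega> \<Longrightarrow> norm x \<le> R \<Longrightarrow>
    \<exists>l \<le> B - A * ln (infdist x (- \<Omega>)). l \<in> disc_chain_lengths \<Omega> o' x \<and> l \<in> disc_chain_lengths \<Omega> x o'"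
    using disc_chain_lengths_from_centre[OF \<Omega> ball_infdist_compl infdist_compl_pos[OF \<Omega> o'], of R] by metis
  have "disc_chain_lengths \<Omega> x y \<noteq> {} \<and>
      kobayashi_dist \<Omega> x y \<le> 2 * B - A * ln (infdist x (- \<Omega>)) - A * ln (infdist y (- \<Omega>))"
    if xy: "x \<in> \<Omega>" "y \<in> \<Omega>" "norm x \<le> R" "norm y \<le> R" for x y
  proof -
    obtain l l' where l: "l \<in> disc_chain_lengths \<Omega> x o'" "l \<le> B - A * ln (infdist x (- \<Omega>))"
      "l' \<in> disc_chain_lengths \<Omega> o' y" "l' \<le> B - A * ln (infdist y (- \<Omega>))"
      using B[OF xy(1,3)] B[OF xy(2,4)] by blast
    have "l + l' \<in> disc_chain_lengths \<Omega> x y" using l disc_chain_lengths_trans by blast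
    then show ?thesis using kobayashi_dist_le[of "l + l'" \<Omega> x y] l by fastforce
  qed
  then show ?thesis using A by blast
qed

lemma disc_dirs_power_estimate:
  fixes \<Omega> :: "(complex ^ 'd) set"
  assumes \<Omega>: "C_properly_convex_domain \<Omega>"
    and simple: "\<And>D. D \<in> affine_orbit_closure \<Omega> \<Longrightarrow> simple_boundary D"
  shows "\<exists>C>0. \<exists>\<epsilon>>0. \<forall>x\<in>\<Omega>. norm x \<le> R \<longrightarrow>
    (\<forall>v\<in>disc_dirs \<Omega> x. norm v \<le> C * infdist x (- \<Omega>) powr \<epsilon>)"
proof -
  note D = C_properly_convex_domainD[OF \<Omega>]
  obtain o' \<rho> where o: "cball o' \<rho> \<subseteq> \<Omega>" "0 < \<rho>"
    using D(1,3) open_contains_cball by blast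
  obtain p where p: "p \<notin> \<Omega>" using C_properly_convex_domain_compl(2)[OF \<Omega>] by blast
  obtain R0 where R0: "0 \<le> R0" "R \<le> R0" using abs_ge_zero abs_ge_self by blast
  define R1 where "R1 = 2 * R0 + norm p"
  obtain N where N: "2 \<le> N" and double: "\<And>q s v. q \<in> closure \<Omega> - \<Omega> \<Longrightarrow> norm q \<le> R1 \<Longrightarrow> 0 < s \<Longrightarrow>
      real N * s \<le> 1 / 2 \<Longrightarrow> v \<in> disc_dirs \<Omega> (q + s *\<^sub>R (o' - q)) \<Longrightarrow>
      2 *\<^sub>R v \<in> disc_dirs \<Omega> (q + (real N * s) *\<^sub>R (o' - q))"
    using disc_dirs_doubling[OF \<Omega> simple o, of R1] by blast
  obtain M where M: "0 < M" "\<And>y v. y \<in> closure \<Omega> \<Longrightarrow> norm y \<le> R1 + norm o' \<Longrightarrow> v \<in> disc_dirs \<Omega> y \<Longrightarrow> norm v \<le> M"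
    using disc_dirs_bounded[OF \<Omega>, of "R1 + norm o'"] by metis
  define \<epsilon> where "\<epsilon> = ln 2 / ln (real N)"
  have \<epsilon>: "0 < \<epsilon>" using N by (simp add: \<epsilon>_def)
  have N_powr: "(real N ^ k) powr \<epsilon> = 2 ^ k" for k
    using N by (simp add: \<epsilon>_def powr_def ln_realpow exp_of_nat2_mult)
  have "norm v \<le> (4 * M * (2 / \<rho>) powr \<epsilon>) * infdist x (- \<Omega>) powr \<epsilon>"
    if x: "x \<in> \<Omega>" "norm x \<le> R" and v: "v \<in> disc_dirs \<Omega> x" for x v
  proof -
    let ?\<delta> = "infdist x (- \<Omega>)"
    have \<delta>: "0 < ?\<delta>" by (rule infdist_compl_pos[OF \<Omega> x(1)])
    define s where "s = ?\<delta> / \<rho>"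
    have s: "0 < s" using \<delta> o(2) by (simp add: s_def)
    have "norm v \<le> 4 * M * (2 * s) powr \<epsilon>"
    proof (cases "s \<le> 1 / 2")
      case False
      have "norm v \<le> M"
      proof (rule M(2)[OF _ _ v])
        show "x \<in> closure \<Omega>" using x(1) closure_subset by blast
        show "norm x \<le> R1 + norm o'"
          using x(2) R0 norm_ge_zero[of p] norm_ge_zero[of o'] unfolding R1_def by linarith
      qed
      also have "\<dots> \<le> 4 * M * 1" using M(1) by simp
      also have "\<dots> \<le> 4 * M * (2 * s) powr \<epsilon>"
        using M(1) False \<epsilon> by (intro mult_left_mono ge_one_powr_ge_zero) auto
      finally show ?thesis .
    next
      case True
      obtain q where q: "q \<in> - \<Omega>" "?\<delta> = dist x q"
        using infdist_attains_inf[OF C_properly_convex_domain_compl[OF \<Omega>]] by blast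
      have "q \<in> closure (ball x ?\<delta>)" using \<delta> q(2) by simp
      then have q_closure: "q \<in> closure \<Omega> - \<Omega>"
        using q(1) closure_mono[OF ball_infdist_compl[of x \<Omega>]] by blast
      have "?\<delta> \<le> dist x p" by (rule infdist_le) (use p in simp)
      also have "\<dots> \<le> norm x + norm p" unfolding dist_norm by (rule norm_triangle_ineq4)
      finally have "norm q \<le> R1"
        using norm_triangle_ineq2[of q x] x(2) q(2) R0 unfolding R1_def dist_norm norm_minus_commute[of q x] by linarith
      define y where "y t = q + t *\<^sub>R (o' - q)" for t
      have half: "(1 / 2) *\<^sub>R v \<in> disc_dirs \<Omega> (y s)"
        unfolding disc_dirs_def
      proof (intro CollectI allI impI)
        fix c :: complex assume c: "cmod c \<le> 1"
        have "norm ((1 / (2 * s)) *\<^sub>R (q - x)) \<le> \<rho>"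
        proof -
          have "norm (q - x) = s * \<rho>" using q(2) o(2) by (simp add: s_def dist_norm norm_minus_commute)
          then show ?thesis unfolding norm_scaleR using s o(2) by simp
        qed
        then have "o' + (1 / (2 * s)) *\<^sub>R (q - x) \<in> cball o' \<rho>" by (simp add: dist_norm)
        then have "o' + (1 / (2 * s)) *\<^sub>R (q - x) \<in> closure \<Omega>" using o(1) closure_subset by blast
        then have "(1 - 2 * s) *\<^sub>R q + (2 * s) *\<^sub>R (o' + (1 / (2 * s)) *\<^sub>R (q - x)) \<in> closure \<Omega>"
          using True s D(2) q_closure by (intro convexD[OF convex_closure]) auto
        moreover have "x + c *s v \<in> closure \<Omega>" by (rule disc_dirsD[OF v c])
        ultimately have "(1 / 2) *\<^sub>R (x + c *s v) +
            (1 / 2) *\<^sub>R ((1 - 2 * s) *\<^sub>R q + (2 * s) *\<^sub>R (o' + (1 / (2 * s)) *\<^sub>R (q - x))) \<in> closure \<Omega>"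
          using convexD[OF convex_closure[OF D(2)], of _ _ "1 / 2" "1 / 2"] by simp
        also have "(1 / 2) *\<^sub>R (x + c *s v) +
            (1 / 2) *\<^sub>R ((1 - 2 * s) *\<^sub>R q + (2 * s) *\<^sub>R (o' + (1 / (2 * s)) *\<^sub>R (q - x))) =
            y s + c *s ((1 / 2) *\<^sub>R v)"
        proof -
          have "(2 * s) *\<^sub>R (o' + (1 / (2 * s)) *\<^sub>R (q - x)) = (2 * s) *\<^sub>R o' + (q - x)"
            using s by (simp add: scaleR_add_right)
          then show ?thesis
            by (simp only: y_def) (simp add: vec_eq_iff scaleR_conv_of_real[where 'a = complex] field_simps)
        qed
        finally show "y s + c *s ((1 / 2) *\<^sub>R v) \<in> closure \<Omega>" .
      qed
      have iter: "real N ^ k * s \<le> 1 / 2 \<longrightarrow> 2 ^ k *\<^sub>R ((1 / 2) *\<^sub>R v) \<in> disc_dirs \<Omega> (y (real N ^ k * s))" for k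
      proof (induction k)
        case 0
        then show ?case using half by simp
      next
        case (Suc k)
        show ?case
        proof
          assume le: "real N ^ Suc k * s \<le> 1 / 2"
          have "real N ^ k * s \<le> real N ^ Suc k * s" using N s by simp
          then have "2 ^ k *\<^sub>R ((1 / 2) *\<^sub>R v) \<in> disc_dirs \<Omega> (y (real N ^ k * s))" using Suc le by simp
          from double[OF q_closure \<open>norm q \<le> R1\<close> _ _ this[unfolded y_def]] le s N
          show "2 ^ Suc k *\<^sub>R ((1 / 2) *\<^sub>R v) \<in> disc_dirs \<Omega> (y (real N ^ Suc k * s))"
            by (simp add: y_def mult.assoc)
        qed
      qed
      obtain k0 where "1 / (2 * s) < real N ^ k0" using real_arch_pow[of "real N"] N by auto
      moreover have "real N ^ k0 \<le> real N ^ Suc k0" using N by simp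
      ultimately have ex: "1 / (2 * s) < real N ^ Suc k0" by linarith
      define k where "k = (LEAST k. 1 / (2 * s) < real N ^ Suc k)"
      have k: "1 / (2 * s) < real N ^ Suc k" unfolding k_def by (rule LeastI[of _ k0]) (rule ex)
      have "real N ^ k \<le> 1 / (2 * s)"
      proof (cases k)
        case 0
        then show ?thesis using True s by simp
      next
        case (Suc j)
        then show ?thesis using not_less_Least[of j "\<lambda>k. 1 / (2 * s) < real N ^ Suc k"] by (simp add: k_def)
      qed
      then have ks: "real N ^ k * s \<le> 1 / 2" using s by (simp add: field_simps)
      have yk: "y (real N ^ k * s) \<in> \<Omega>"
        unfolding y_def using q_closure o s ks N by (intro segment_in_domain[OF \<Omega>]) auto
      have "norm (y (real N ^ k * s)) \<le> R1 + norm o'"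
      proof -
        let ?t = "real N ^ k * s"
        have "y ?t = (1 - ?t) *\<^sub>R q + ?t *\<^sub>R o'" by (simp add: y_def algebra_simps)
        then have "norm (y ?t) \<le> norm ((1 - ?t) *\<^sub>R q) + norm (?t *\<^sub>R o')" by (metis norm_triangle_ineq)
        also have "\<dots> = (1 - ?t) * norm q + ?t * norm o'" using ks s by simp
        also have "\<dots> \<le> 1 * norm q + 1 * norm o'" using ks s N by (intro add_mono mult_right_mono) auto
        finally show ?thesis using \<open>norm q \<le> R1\<close> by simp
      qed
      then have "norm (2 ^ k *\<^sub>R ((1 / 2) *\<^sub>R v)) \<le> M"
        using M(2) yk closure_subset[of \<Omega>] iter[of k] ks by blast
      then have v_le: "norm v * 2 ^ k \<le> 2 * M" by (simp add: mult.commute)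
      have "(1 / (2 * s)) powr \<epsilon> \<le> (real N ^ Suc k) powr \<epsilon>"
        using k s \<epsilon> by (intro powr_mono2) auto
      then have "1 / (2 * s) powr \<epsilon> \<le> 2 ^ Suc k" unfolding N_powr using s by (simp add: powr_divide)
      then have "1 \<le> 2 * 2 ^ k * (2 * s) powr \<epsilon>" using s by (simp add: field_simps)
      then have "norm v * 1 \<le> norm v * (2 * 2 ^ k * (2 * s) powr \<epsilon>)" by (intro mult_left_mono) auto
      also have "\<dots> = 2 * (norm v * 2 ^ k) * (2 * s) powr \<epsilon>" by simp
      also have "\<dots> \<le> 2 * (2 * M) * (2 * s) powr \<epsilon>" using v_le by (intro mult_right_mono mult_left_mono) auto
      finally show ?thesis by simp
    qed
    also have "(2 * s) powr \<epsilon> = (2 / \<rho>) powr \<epsilon> * ?\<delta> powr \<epsilon>"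
      using \<delta> o(2) by (simp add: s_def powr_mult[symmetric])
    finally show ?thesis by simp
  qed
  moreover have "0 < 4 * M * (2 / \<rho>) powr \<epsilon>" using M(1) o(2) by simp
  ultimately show ?thesis using \<epsilon> by blast
qed

section \<open>Geodesics near the boundary\<close>

lemma kobayashi_geodesic_step:
  fixes \<Omega> :: "(complex ^ 'd) set"
  assumes \<Omega>: "C_properly_convex_domain \<Omega>" and \<sigma>: "kobayashi_geodesic \<Omega> I \<sigma>"
    and st: "s \<in> I" "t \<in> I" and m: "0 < m" "m * (exp (2 * \<bar>t - s\<bar>) - 1) < 1"
  shows "m *\<^sub>R (\<sigma> t - \<sigma> s) \<in> disc_dirs \<Omega> (\<sigma> s)"
proof (rule disc_dirs_of_kobayashi_dist[OF \<Omega>])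
  show x: "\<sigma> s \<in> \<Omega>" using \<sigma> st by (auto simp: kobayashi_geodesic_def)
  have "\<sigma> t \<in> \<Omega>" using \<sigma> st by (auto simp: kobayashi_geodesic_def)
  with x show "disc_chain_lengths \<Omega> (\<sigma> s) (\<sigma> t) \<noteq> {}"
    using kobayashi_dist_upper_bound[OF \<Omega>, of "max (norm (\<sigma> s)) (norm (\<sigma> t))"] by fastforce
  have "kobayashi_dist \<Omega> (\<sigma> s) (\<sigma> t) = \<bar>t - s\<bar>"
    using \<sigma> st by (simp add: kobayashi_geodesic_def abs_minus_commute)
  then show "m * (exp (2 * kobayashi_dist \<Omega> (\<sigma> s) (\<sigma> t)) - 1) < 1" using m by simp
qed (rule m)

lemma kobayashi_geodesic_continuous:
  fixes \<Omega> :: "(complex ^ 'd) set"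
  assumes \<Omega>: "C_properly_convex_domain \<Omega>" and \<sigma>: "kobayashi_geodesic \<Omega> I \<sigma>"
  shows "continuous_on I \<sigma>"
  unfolding continuous_on_def
proof
  fix s assume s: "s \<in> I"
  have "\<sigma> s \<in> closure \<Omega>" using \<sigma> s closure_subset by (auto simp: kobayashi_geodesic_def)
  then obtain M where M: "0 < M" "\<And>v. v \<in> disc_dirs \<Omega> (\<sigma> s) \<Longrightarrow> norm v \<le> M"
    using disc_dirs_bounded[OF \<Omega>, of "norm (\<sigma> s)"] by blast
  have "norm (\<sigma> t - \<sigma> s) \<le> M * (2 * (exp (2 * \<bar>t - s\<bar>) - 1))" if t: "t \<in> I" for t
  proof (cases "t = s")
    case False
    define e where "e = exp (2 * \<bar>t - s\<bar>) - 1"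
    have e: "0 < e" using False by (simp add: e_def)
    have "(1 / (2 * e)) *\<^sub>R (\<sigma> t - \<sigma> s) \<in> disc_dirs \<Omega> (\<sigma> s)"
    proof (rule kobayashi_geodesic_step[OF \<Omega> \<sigma> s t])
      show "0 < 1 / (2 * e)" using e by simp
      show "1 / (2 * e) * (exp (2 * \<bar>t - s\<bar>) - 1) < 1" unfolding e_def[symmetric] using e by simp
    qed
    from M(2)[OF this] have "(1 / (2 * e)) * norm (\<sigma> t - \<sigma> s) \<le> M"
      unfolding norm_scaleR using e by simp
    then have "norm (\<sigma> t - \<sigma> s) \<le> M * (2 * e)" using e by (simp add: field_simps)
    then show ?thesis by (simp only: e_def)
  qed simp
  then have "\<forall>\<^sub>F t in at s within I. norm (\<sigma> t - \<sigma> s) \<le> M * (2 * (exp (2 * \<bar>t - s\<bar>) - 1))"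
    by (simp add: eventually_at_filter)
  moreover
  have "((\<lambda>t. M * (2 * (exp (2 * \<bar>t - s\<bar>) - 1))) \<longlongrightarrow> M * (2 * (exp (2 * \<bar>s - s\<bar>) - 1))) (at s within I)"
    by (intro tendsto_intros)
  then have "((\<lambda>t. M * (2 * (exp (2 * \<bar>t - s\<bar>) - 1))) \<longlongrightarrow> 0) (at s within I)" by simp
  ultimately have "((\<lambda>t. \<sigma> t - \<sigma> s) \<longlongrightarrow> 0) (at s within I)"
    by (rule Lim_null_comparison)
  then show "(\<sigma> \<longlongrightarrow> \<sigma> s) (at s within I)" by (rule LIM_zero_cancel)
qed

lemma norm_le_of_exponential_steps:
  fixes \<gamma> :: "real \<Rightarrow> 'a::real_normed_vector"
  assumes step: "\<And>u u'. 0 \<le> u \<Longrightarrow> u \<le> u' \<Longrightarrow> u' \<le> U \<Longrightarrow> u' - u \<le> 1 \<Longrightarrow> norm (\<gamma> u' - \<gamma> u) \<le> c * exp (- \<beta> * u)"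
    and "0 < \<beta>" "0 \<le> c" "0 \<le> u" "u \<le> U"
  shows "norm (\<gamma> u - \<gamma> 0) \<le> c / (1 - exp (- \<beta>))"
proof -
  let ?\<rho> = "exp (- \<beta>)"
  have \<rho>: "0 < ?\<rho>" "?\<rho> < 1" using assms(2) by auto
  have bound: "norm (\<gamma> u - \<gamma> 0) \<le> c * ((1 - ?\<rho> ^ n) / (1 - ?\<rho>))" if "0 \<le> u" "u \<le> U" "u \<le> real n" for n u
    using that
  proof (induction n arbitrary: u)
    case 0
    then show ?case by simp
  next
    case (Suc n)
    show ?case
    proof (cases "u \<le> real n")
      case True
      then have "norm (\<gamma> u - \<gamma> 0) \<le> c * ((1 - ?\<rho> ^ n) / (1 - ?\<rho>))" using Suc by blast
      also have "\<dots> \<le> c * ((1 - ?\<rho> ^ Suc n) / (1 - ?\<rho>))"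
        using \<rho> assms(3) power_decreasing[of n "Suc n" ?\<rho>] by (intro mult_left_mono divide_right_mono) auto
      finally show ?thesis .
    next
      case False
      have "norm (\<gamma> u - \<gamma> 0) \<le> norm (\<gamma> u - \<gamma> (real n)) + norm (\<gamma> (real n) - \<gamma> 0)"
        using norm_triangle_ineq[of "\<gamma> u - \<gamma> (real n)" "\<gamma> (real n) - \<gamma> 0"] by simp
      also have "\<dots> \<le> c * exp (- \<beta> * real n) + c * ((1 - ?\<rho> ^ n) / (1 - ?\<rho>))"
        using False Suc.prems by (intro add_mono step Suc.IH) auto
      also have "exp (- \<beta> * real n) = ?\<rho> ^ n" by (rule exp_of_nat2_mult)
      also have "c * ?\<rho> ^ n + c * ((1 - ?\<rho> ^ n) / (1 - ?\<rho>)) = c * ((1 - ?\<rho> ^ Suc n) / (1 - ?\<rho>))"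
        using \<rho> by (simp add: field_simps)
      finally show ?thesis .
    qed
  qed
  obtain n where "u \<le> real n" using real_arch_simple by blast
  then have "norm (\<gamma> u - \<gamma> 0) \<le> c * ((1 - ?\<rho> ^ n) / (1 - ?\<rho>))" using bound assms by blast
  also have "\<dots> \<le> c * (1 / (1 - ?\<rho>))"
    using \<rho> assms(3) by (intro mult_left_mono divide_right_mono) auto
  finally show ?thesis by simp
qed

text \<open>Measured from the parameter \<open>t0\<close> where the boundary distance \<open>\<delta>\<close> attains its maximum
  \<open>h0\<close>, the logarithmic upper bound for the Kobayashi distance gives
  \<open>\<delta> \<cdot> h0 \<lesssim> exp (- \<bar>t - t0\<bar> / A)\<close>; hence \<open>\<delta> ^ 3 \<le> \<delta> h0 \<cdot> h0\<close> decays exponentially, and by the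
  power estimate so do the Euclidean lengths of unit Kobayashi steps.\<close>

lemma kobayashi_geodesic_near_boundary:
  fixes \<Omega> :: "(complex ^ 'd) set"
  assumes \<Omega>: "C_properly_convex_domain \<Omega>"
    and simple: "\<And>D. D \<in> affine_orbit_closure \<Omega> \<Longrightarrow> simple_boundary D"
  shows "\<exists>C>0. \<exists>\<epsilon>>0. \<forall>\<sigma> a b h. a \<le> b \<longrightarrow> kobayashi_geodesic \<Omega> {a..b} \<sigma> \<longrightarrow>
    (\<forall>t\<in>{a..b}. norm (\<sigma> t) \<le> R \<and> infdist (\<sigma> t) (- \<Omega>) \<le> h) \<longrightarrow>
    norm (\<sigma> a - \<sigma> b) \<le> C * h powr \<epsilon>"
proof -
  obtain C \<epsilon> where C: "0 < C" and \<epsilon>: "0 < \<epsilon>"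
    and power: "\<And>x v. x \<in> \<Omega> \<Longrightarrow> norm x \<le> R \<Longrightarrow> v \<in> disc_dirs \<Omega> x \<Longrightarrow> norm v \<le> C * infdist x (- \<Omega>) powr \<epsilon>"
    using disc_dirs_power_estimate[OF \<Omega> simple, of R] by metis
  obtain A B where A: "0 < A" and B: "\<And>x y. x \<in> \<Omega> \<Longrightarrow> y \<in> \<Omega> \<Longrightarrow> norm x \<le> R \<Longrightarrow> norm y \<le> R \<Longrightarrow>
      kobayashi_dist \<Omega> x y \<le> B - A * ln (infdist x (- \<Omega>)) - A * ln (infdist y (- \<Omega>))"
    using kobayashi_dist_upper_bound[OF \<Omega>, of R] by metis
  define \<beta> where "\<beta> = \<epsilon> / (3 * A)"
  have \<beta>: "0 < \<beta>" using \<epsilon> A by (simp add: \<beta>_def)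
  define K where "K = 9 * C * exp (\<beta> * B) / (1 - exp (- \<beta>))"
  have K: "0 < K" using C \<beta> by (simp add: K_def)
  have main: "norm (\<sigma> a - \<sigma> b) \<le> (2 * K) * h powr (\<epsilon> / 3)"
    if ab: "a \<le> b" and \<sigma>: "kobayashi_geodesic \<Omega> {a..b} \<sigma>"
      and near: "\<And>t. t \<in> {a..b} \<Longrightarrow> norm (\<sigma> t) \<le> R \<and> infdist (\<sigma> t) (- \<Omega>) \<le> h" for \<sigma> a b h
  proof -
    define \<delta> where "\<delta> t = infdist (\<sigma> t) (- \<Omega>)" for t
    have in_\<Omega>: "\<sigma> t \<in> \<Omega>" if "t \<in> {a..b}" for t using \<sigma> that by (auto simp: kobayashi_geodesic_def)
    have \<delta>_pos: "0 < \<delta> t" if "t \<in> {a..b}" for t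
      unfolding \<delta>_def by (rule infdist_compl_pos[OF \<Omega> in_\<Omega>[OF that]])
    have "continuous_on {a..b} \<delta>"
      unfolding \<delta>_def by (intro continuous_intros kobayashi_geodesic_continuous[OF \<Omega> \<sigma>])
    then obtain t0 where t0: "t0 \<in> {a..b}" and max: "\<And>t. t \<in> {a..b} \<Longrightarrow> \<delta> t \<le> \<delta> t0"
      using continuous_attains_sup[of "{a..b}" \<delta>] ab by auto
    define h0 where "h0 = \<delta> t0"
    have h0: "0 < h0" "h0 \<le> h" using \<delta>_pos[OF t0] near[OF t0] by (simp_all add: h0_def \<delta>_def)
    define c where "c = 9 * C * exp (\<beta> * B) * h0 powr (\<epsilon> / 3)"
    have c: "0 \<le> c" using C by (simp add: c_def)
    have decay: "9 * C * \<delta> t powr \<epsilon> \<le> c * exp (- \<beta> * \<bar>t - t0\<bar>)" if t: "t \<in> {a..b}" for t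
    proof -
      have "\<bar>t - t0\<bar> = kobayashi_dist \<Omega> (\<sigma> t0) (\<sigma> t)"
        using \<sigma> t t0 by (simp add: kobayashi_geodesic_def abs_minus_commute)
      also have "\<dots> \<le> B - A * ln h0 - A * ln (\<delta> t)"
        using B[OF in_\<Omega>[OF t0] in_\<Omega>[OF t]] near[OF t] near[OF t0] by (simp add: h0_def \<delta>_def)
      finally have dist: "A * (ln h0 + ln (\<delta> t)) \<le> B - \<bar>t - t0\<bar>" by (simp add: algebra_simps)
      have "ln (\<delta> t) \<le> ln h0" using max[OF t] \<delta>_pos[OF t] h0(1) by (simp add: h0_def)
      then have "A * (3 * ln (\<delta> t)) \<le> A * ((ln h0 + ln (\<delta> t)) + ln h0)"
        using A by (intro mult_left_mono) auto
      then have "A * (3 * ln (\<delta> t)) \<le> B - \<bar>t - t0\<bar> + A * ln h0"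
        using dist by (simp add: algebra_simps)
      then have le: "\<beta> * (A * (3 * ln (\<delta> t))) \<le> \<beta> * (B - \<bar>t - t0\<bar> + A * ln h0)"
        using \<beta> by (intro mult_left_mono) auto
      have eqs: "\<beta> * (A * (3 * ln (\<delta> t))) = \<epsilon> * ln (\<delta> t)" "\<beta> * (A * ln h0) = (\<epsilon> / 3) * ln h0"
        using A by (simp_all add: \<beta>_def)
      have "\<beta> * (B - \<bar>t - t0\<bar> + A * ln h0) = \<beta> * B + \<beta> * (A * ln h0) + - \<beta> * \<bar>t - t0\<bar>"
        by (simp add: algebra_simps)
      then have "\<epsilon> * ln (\<delta> t) \<le> \<beta> * B + (\<epsilon> / 3) * ln h0 + - \<beta> * \<bar>t - t0\<bar>"
        using le unfolding eqs by simp
      then have "exp (\<epsilon> * ln (\<delta> t)) \<le> exp (\<beta> * B + (\<epsilon> / 3) * ln h0 + - \<beta> * \<bar>t - t0\<bar>)"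
        by (simp only: exp_le_cancel_iff)
      also have "\<dots> = exp (\<beta> * B) * h0 powr (\<epsilon> / 3) * exp (- \<beta> * \<bar>t - t0\<bar>)"
        using h0(1) by (simp only: exp_add powr_def) simp
      also have "exp (\<epsilon> * ln (\<delta> t)) = \<delta> t powr \<epsilon>" using \<delta>_pos[OF t] by (simp add: powr_def)
      finally have "9 * C * \<delta> t powr \<epsilon> \<le> 9 * C * (exp (\<beta> * B) * h0 powr (\<epsilon> / 3) * exp (- \<beta> * \<bar>t - t0\<bar>))"
        using C by (intro mult_left_mono) auto
      then show ?thesis by (simp add: c_def mult.assoc)
    qed
    have step: "norm (\<sigma> t - \<sigma> s) \<le> c * exp (- \<beta> * \<bar>s - t0\<bar>)"
      if st: "s \<in> {a..b}" "t \<in> {a..b}" "\<bar>t - s\<bar> \<le> 1" for s t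
    proof -
      have "exp (2 * \<bar>t - s\<bar>) \<le> exp 2" using st(3) by simp
      also have "exp (2 :: real) = exp 1 * exp 1" by (simp add: exp_add[symmetric])
      also have "\<dots> \<le> 3 * 3" using exp_le by (intro mult_mono) auto
      finally have "(1 / 9) * (exp (2 * \<bar>t - s\<bar>) - 1) < 1" by simp
      then have "(1 / 9) *\<^sub>R (\<sigma> t - \<sigma> s) \<in> disc_dirs \<Omega> (\<sigma> s)"
        by (intro kobayashi_geodesic_step[OF \<Omega> \<sigma> st(1,2)]) auto
      then have "norm ((1 / 9) *\<^sub>R (\<sigma> t - \<sigma> s)) \<le> C * \<delta> s powr \<epsilon>"
        unfolding \<delta>_def using near[OF st(1)] by (intro power in_\<Omega> st) auto
      then have "norm (\<sigma> t - \<sigma> s) \<le> 9 * C * \<delta> s powr \<epsilon>" unfolding norm_scaleR by simp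
      then show ?thesis using decay[OF st(1)] by linarith
    qed
    have "norm (\<sigma> (t0 + (b - t0)) - \<sigma> (t0 + 0)) \<le> c / (1 - exp (- \<beta>))"
    proof (rule norm_le_of_exponential_steps[where \<gamma> = "\<lambda>u. \<sigma> (t0 + u)" and U = "b - t0"])
      fix u u' assume "0 \<le> u" "u \<le> u'" "u' \<le> b - t0" "u' - u \<le> 1"
      then show "norm (\<sigma> (t0 + u') - \<sigma> (t0 + u)) \<le> c * exp (- \<beta> * u)"
        using step[of "t0 + u" "t0 + u'"] t0 by simp
    qed (use \<beta> c t0 in auto)
    moreover have "norm (\<sigma> (t0 - (t0 - a)) - \<sigma> (t0 - 0)) \<le> c / (1 - exp (- \<beta>))"
    proof (rule norm_le_of_exponential_steps[where \<gamma> = "\<lambda>u. \<sigma> (t0 - u)" and U = "t0 - a"])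
      fix u u' assume "0 \<le> u" "u \<le> u'" "u' \<le> t0 - a" "u' - u \<le> 1"
      then show "norm (\<sigma> (t0 - u') - \<sigma> (t0 - u)) \<le> c * exp (- \<beta> * u)"
        using step[of "t0 - u" "t0 - u'"] t0 by simp
    qed (use \<beta> c t0 in auto)
    ultimately have "norm (\<sigma> a - \<sigma> b) \<le> 2 * (c / (1 - exp (- \<beta>)))"
      using norm_triangle_ineq4[of "\<sigma> a - \<sigma> t0" "\<sigma> b - \<sigma> t0"] by simp
    also have "\<dots> = 2 * K * h0 powr (\<epsilon> / 3)" by (simp add: c_def K_def)
    also have "\<dots> \<le> 2 * K * h powr (\<epsilon> / 3)"
      using K h0 \<epsilon> by (intro mult_left_mono powr_mono2) auto
    finally show ?thesis .
  qed
  show ?thesis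
  proof (rule exI[of _ "2 * K"], rule conjI, use K in simp, rule exI[of _ "\<epsilon> / 3"], intro conjI allI impI)
    show "0 < \<epsilon> / 3" using \<epsilon> by simp
  qed (rule main, simp_all)
qed

lemma limitin_end_compactification_Point:
  assumes "limitin (end_compactification X) (\<lambda>n. Point (x n)) (Point p) F"
  shows "p \<in> X" "(x \<longlongrightarrow> p) F"
proof -
  have "Point p \<in> topspace (end_compactification X)" using assms by (simp add: limitin_def)
  then show p: "p \<in> X" by (auto simp: topspace_end_compactification)
  show "(x \<longlongrightarrow> p) F"
  proof (rule topological_tendstoI)
    fix V assume V: "open V" "p \<in> V"
    have "{x. Point x \<in> Point ` (X \<inter> V)} = X \<inter> V" by auto
    then have "end_open X (Point ` (X \<inter> V))"
      unfolding end_open_def using V(1) by (auto simp: openin_open_Int)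
    then have "\<forall>\<^sub>F n in F. Point (x n) \<in> Point ` (X \<inter> V)"
      using assms p V(2) by (auto simp: limitin_def openin_end_compactification)
    then show "\<forall>\<^sub>F n in F. x n \<in> V" by (rule eventually_mono) auto
  qed
qed

lemma ends_component: "e \<in> ends X \<Longrightarrow> compact K \<Longrightarrow> K \<subseteq> X \<Longrightarrow> e K \<in> components (X - K)"
  unfolding ends_def PiE_iff by blast

lemma limitin_end_compactification_End:
  assumes lim: "limitin (end_compactification X) (\<lambda>n. Point (x n)) (End e) F"
    and X: "locally connected X" and K: "compact K" "K \<subseteq> X" "closed K"
  shows "e \<in> ends X" "\<forall>\<^sub>F n in F. x n \<in> e K"
proof -
  have "End e \<in> topspace (end_compactification X)" using lim by (simp add: limitin_def)
  then show e: "e \<in> ends X" by (auto simp: topspace_end_compactification)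
  let ?U = "Point ` e K \<union> End ` {e' \<in> ends X. e' K = e K}"
  have comp: "e K \<in> components (X - K)" by (rule ends_component[OF e K(1,2)])
  then have eK: "e K \<subseteq> X" using in_components_subset by fastforce
  have "X - K = X \<inter> - K" by blast
  then have XK: "openin (top_of_set X) (X - K)" using K(3) by (metis open_Compl openin_open_Int)
  then have "locally connected (X - K)" using X by (rule locally_open_subset[rotated])
  then have "openin (top_of_set (X - K)) (e K)" using comp by (rule openin_components_locally_connected)
  then have "openin (top_of_set X) (e K)" using XK by (rule openin_trans)
  moreover have "{x. Point x \<in> ?U} = e K" by auto
  ultimately have "end_open X ?U"
    unfolding end_open_def using eK K by auto
  then have "\<forall>\<^sub>F n in F. Point (x n) \<in> ?U"
    using lim e by (auto simp: limitin_def openin_end_compactification)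
  then show "\<forall>\<^sub>F n in F. x n \<in> e K" by (rule eventually_mono) auto
qed

lemma limitin_end_compactification_avoid:
  fixes X :: "'a::{heine_borel,real_normed_vector} set"
  assumes X: "closed X" "locally connected X" and p: "p \<in> X"
    and y: "limitin (end_compactification X) (\<lambda>n. Point (y n)) \<eta> F" and ne: "\<eta> \<noteq> Point p"
  shows "\<exists>\<epsilon>>0. \<forall>\<^sub>F n in F. \<epsilon> < dist p (y n)"
proof (cases \<eta>)
  case (Point q)
  then have y': "(y \<longlongrightarrow> q) F" using limitin_end_compactification_Point y by blast
  have pq: "0 < dist p q" using ne Point by auto
  have "((\<lambda>n. dist p (y n)) \<longlongrightarrow> dist p q) F" by (intro tendsto_intros y')
  then have "\<forall>\<^sub>F n in F. dist p q / 2 < dist p (y n)" by (rule order_tendstoD(1)) (use pq in simp)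
  then show ?thesis using pq by (intro exI[of _ "dist p q / 2"]) simp
next
  case (End e)
  have K: "compact (X \<inter> cball p 1)" "closed (X \<inter> cball p 1)" using X by (auto simp: closed_Int_compact)
  have "\<forall>\<^sub>F n in F. y n \<in> e (X \<inter> cball p 1)"
    using limitin_end_compactification_End(2)[OF y[unfolded End] X(2) K(1) _ K(2)] by blast
  moreover have "e (X \<inter> cball p 1) \<subseteq> X - cball p 1"
    using ends_component[OF limitin_end_compactification_End(1)[OF y[unfolded End] X(2) K(1) _ K(2)] K(1)]
      in_components_subset by fastforce
  ultimately have "\<forall>\<^sub>F n in F. 1 < dist p (y n)" by (auto elim!: eventually_mono)
  then show ?thesis by (intro exI[of _ 1]) simp
qed

lemma first_exit_time:
  fixes f :: "real \<Rightarrow> real"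
  assumes f: "continuous_on (closed_segment T E) f" and "f T < \<epsilon>" "\<epsilon> < f E"
  obtains E' where "E' \<in> closed_segment T E" "f E' = \<epsilon>" "\<And>t. t \<in> closed_segment T E' \<Longrightarrow> f t \<le> \<epsilon>"
proof -
  have ivt: "\<exists>s\<in>closed_segment T t. f s = \<epsilon>" if t: "t \<in> closed_segment T E" "\<epsilon> < f t" for t
  proof -
    have "closed_segment T t \<subseteq> closed_segment T E" using t(1) by (simp add: subset_closed_segment)
    then have "connected (f ` closed_segment T t)"
      using f by (intro connected_continuous_image continuous_on_subset[OF f]) auto
    then have "{f T..f t} \<subseteq> f ` closed_segment T t" by (rule connected_contains_Icc) auto
    moreover have "\<epsilon> \<in> {f T..f t}" using assms(2) t(2) by simp
    ultimately have "\<epsilon> \<in> f ` closed_segment T t" by (rule subsetD)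
    then obtain s where "s \<in> closed_segment T t" "\<epsilon> = f s" by (rule imageE)
    then show ?thesis by (intro bexI[of _ s]) simp_all
  qed
  define S where "S = {t \<in> closed_segment T E. f t = \<epsilon>}"
  have "closed S"
    unfolding S_def using continuous_closed_preimage_constant[OF f] by simp
  moreover have "S \<subseteq> closed_segment T E" by (auto simp: S_def)
  then have "closed_segment T E \<inter> S = S" by blast
  ultimately have "compact S" using compact_Int_closed[OF compact_segment[of T E], of S] by simp
  moreover have "S \<noteq> {}" using ivt[of E] assms(3) by (auto simp: S_def)
  ultimately obtain E' where E': "E' \<in> S" "\<And>s. s \<in> S \<Longrightarrow> dist T E' \<le> dist T s"
    using continuous_attains_inf[of S "\<lambda>t. dist T t", OF _ _ continuous_on_dist[OF continuous_on_const continuous_on_id]]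
    by blast
  have sub: "closed_segment T E' \<subseteq> closed_segment T E" using E'(1) by (simp add: S_def subset_closed_segment)
  show ?thesis
  proof (rule that[of E'])
    fix t assume t: "t \<in> closed_segment T E'"
    show "f t \<le> \<epsilon>"
    proof (rule ccontr)
      assume "\<not> f t \<le> \<epsilon>"
      then have "\<epsilon> < f t" by simp
      then obtain s where s: "s \<in> closed_segment T t" "f s = \<epsilon>" using ivt[OF subsetD[OF sub t]] by blast
      then have "s \<in> S" using t sub by (auto simp: S_def closed_segment_eq_real_ivl split: if_splits)
      moreover have "dist T s < dist T E'"
        using s t \<open>\<not> f t \<le> \<epsilon>\<close> by (cases "s = t") (auto simp: closed_segment_eq_real_ivl dist_real_def split: if_splits)
      ultimately show False using E'(2) by force
    qed
  qed (use E'(1) in \<open>auto simp: S_def\<close>)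
qed

lemma end_separated_geodesics:
  fixes \<Omega> :: "(complex ^ 'd) set"
  assumes \<Omega>: "C_properly_convex_domain \<Omega>"
    and ab: "\<And>n. a n \<le> b n" and \<sigma>: "\<And>n. kobayashi_geodesic \<Omega> {a n..b n} (\<sigma> n)"
    and \<xi>: "limitin (end_compactification (closure \<Omega>)) (\<lambda>n. Point (\<sigma> n (a n))) \<xi> sequentially"
    and \<eta>: "limitin (end_compactification (closure \<Omega>)) (\<lambda>n. Point (\<sigma> n (b n))) \<eta> sequentially"
    and ne: "\<xi> \<noteq> \<eta>"
  shows "\<exists>(r :: nat \<Rightarrow> nat) p \<epsilon> T E. strict_mono r \<and> 0 < \<epsilon> \<and>
    (\<forall>j. T j \<in> {a (r j)..b (r j)} \<and> E j \<in> {a (r j)..b (r j)}) \<and>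
    (\<lambda>j. \<sigma> (r j) (T j)) \<longlonglongrightarrow> p \<and> (\<forall>\<^sub>F j in sequentially. \<epsilon> < dist p (\<sigma> (r j) (E j)))"
proof -
  let ?X = "closure \<Omega>"
  note D = C_properly_convex_domainD[OF \<Omega>]
  have X: "closed ?X" "locally connected ?X"
    using D(2) by (auto intro: convex_imp_locally_connected)
  show ?thesis
  proof (cases \<xi>)
    case (Point p)
    note p = limitin_end_compactification_Point[OF \<xi>[unfolded Point]]
    obtain \<epsilon> where "0 < \<epsilon>" "\<forall>\<^sub>F n in sequentially. \<epsilon> < dist p (\<sigma> n (b n))"
      using limitin_end_compactification_avoid[OF X p(1) \<eta>] ne Point by blast
    then show ?thesis using p(2) ab
      by (intro exI[of _ id] exI[of _ p] exI[of _ \<epsilon>] exI[of _ a] exI[of _ b]) (auto simp: strict_mono_def)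
  next
    case (End e)
    note e = End
    show ?thesis
    proof (cases \<eta>)
      case (Point p)
      note p = limitin_end_compactification_Point[OF \<eta>[unfolded Point]]
      obtain \<epsilon> where "0 < \<epsilon>" "\<forall>\<^sub>F n in sequentially. \<epsilon> < dist p (\<sigma> n (a n))"
        using limitin_end_compactification_avoid[OF X p(1) \<xi>] ne Point by blast
      then show ?thesis using p(2) ab
        by (intro exI[of _ id] exI[of _ p] exI[of _ \<epsilon>] exI[of _ b] exI[of _ a]) (auto simp: strict_mono_def)
    next
      case (End e')
      have end_ev: "\<forall>\<^sub>F n in sequentially. \<sigma> n (a n) \<in> e K" "\<forall>\<^sub>F n in sequentially. \<sigma> n (b n) \<in> e' K"
        if "compact K" "K \<subseteq> ?X" for K
        by (rule limitin_end_compactification_End(2)[OF \<xi>[unfolded e] X(2) that compact_imp_closed[OF that(1)]],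
            rule limitin_end_compactification_End(2)[OF \<eta>[unfolded End] X(2) that compact_imp_closed[OF that(1)]])
      have ends: "e \<in> ends ?X" "e' \<in> ends ?X"
        using limitin_end_compactification_End(1)[OF \<xi>[unfolded e] X(2) compact_empty]
          limitin_end_compactification_End(1)[OF \<eta>[unfolded End] X(2) compact_empty] by auto
      have "\<exists>K. compact K \<and> K \<subseteq> ?X \<and> e K \<noteq> e' K"
      proof (rule ccontr)
        assume eq: "\<not> ?thesis"
        have "e K = e' K" for K
        proof (cases "compact K \<and> K \<subseteq> ?X")
          case False
          then show ?thesis using ends unfolding ends_def by (auto simp: PiE_def extensional_def)
        qed (use eq in blast)
        then show False using ne e End by (simp add: fun_eq_iff)
      qed
      then obtain K where K: "compact K" "K \<subseteq> ?X" "e K \<noteq> e' K" by blast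
      have "\<forall>\<^sub>F n in sequentially. \<exists>t\<in>{a n..b n}. \<sigma> n t \<in> K"
        using end_ev[OF K(1,2)]
      proof eventually_elim
        case (elim n)
        show ?case
        proof (rule ccontr)
          assume avoid: "\<not> (\<exists>t\<in>{a n..b n}. \<sigma> n t \<in> K)"
          have "\<sigma> n ` {a n..b n} \<subseteq> \<Omega>" using \<sigma>[of n] by (simp add: kobayashi_geodesic_def)
          then have "\<sigma> n ` {a n..b n} \<subseteq> ?X - K" using avoid closure_subset[of \<Omega>] by blast
          moreover have "connected (\<sigma> n ` {a n..b n})"
            by (intro connected_continuous_image kobayashi_geodesic_continuous[OF \<Omega> \<sigma>]) auto
          moreover have "e K \<inter> \<sigma> n ` {a n..b n} \<noteq> {}" using elim(1) ab[of n] by auto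
          ultimately have "\<sigma> n ` {a n..b n} \<subseteq> e K"
            using components_maximal[OF ends_component[OF ends(1) K(1,2)]] by blast
          then have "\<sigma> n (b n) \<in> e K" using ab[of n] by auto
          then have "e K \<inter> e' K \<noteq> {}" using elim(2) by blast
          then show False
            using components_nonoverlap[OF ends_component[OF ends(1) K(1,2)] ends_component[OF ends(2) K(1,2)]] K(3)
            by blast
        qed
      qed
      then obtain N where N: "\<And>n. n \<ge> N \<Longrightarrow> \<exists>t\<in>{a n..b n}. \<sigma> n t \<in> K"
        unfolding eventually_sequentially by blast
      have "\<forall>n. \<exists>t. t \<in> {a (n + N)..b (n + N)} \<and> \<sigma> (n + N) t \<in> K"
        using N[OF le_add2] by blast
      from choice[OF this]
      obtain t where t: "\<And>n. t n \<in> {a (n + N)..b (n + N)}" "\<And>n. \<sigma> (n + N) (t n) \<in> K" by blast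
      obtain p r where p: "p \<in> K" "strict_mono r" "((\<lambda>n. \<sigma> (n + N) (t n)) \<circ> r) \<longlonglongrightarrow> p"
        using seq_compactE[OF compact_imp_seq_compact[OF K(1)], of "\<lambda>n. \<sigma> (n + N) (t n)"] t(2) by blast
      let ?K' = "?X \<inter> cball p 1"
      have K': "compact ?K'" "?K' \<subseteq> ?X" by (auto simp: closed_Int_compact)
      have "e ?K' \<subseteq> ?X - cball p 1"
        using ends_component[OF ends(1) K'] in_components_subset by fastforce
      then have "\<forall>\<^sub>F n in sequentially. 1 < dist p (\<sigma> n (a n))"
        using end_ev(1)[OF K'] by (auto elim!: eventually_mono)
      moreover have rN: "strict_mono (\<lambda>j. r j + N)" using p(2) by (simp add: strict_mono_def)
      ultimately have "\<forall>\<^sub>F j in sequentially. 1 < dist p (\<sigma> (r j + N) (a (r j + N)))"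
        using eventually_subseq[of "\<lambda>j. r j + N"] by blast
      then show ?thesis
        using rN t(1) p(3) ab
        by (intro exI[of _ "\<lambda>j. r j + N"] exI[of _ p] exI[of _ 1] exI[of _ "t \<circ> r"]
            exI[of _ "\<lambda>j. a (r j + N)"]) (auto simp: o_def)
    qed
  qed
qed

theorem proposition8p1:
  fixes \<Omega> :: "(complex ^ 'd) set"
    and \<sigma> :: "nat \<Rightarrow> real \<Rightarrow> complex ^ 'd"
    and a b :: "nat \<Rightarrow> real"
    and \<xi> \<eta> :: "(complex ^ 'd) end_completion"
  assumes "C_properly_convex_domain \<Omega>"
    and "\<And>D. D \<in> affine_orbit_closure \<Omega> \<Longrightarrow> simple_boundary D"
    and "\<And>n. a n \<le> b n"
    and "\<And>n. kobayashi_geodesic \<Omega> {a n..b n} (\<sigma> n)"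
    and "limitin (end_compactification (closure \<Omega>)) (\<lambda>n. Point (\<sigma> n (a n))) \<xi> sequentially"
    and "limitin (end_compactification (closure \<Omega>)) (\<lambda>n. Point (\<sigma> n (b n))) \<eta> sequentially"
    and "\<xi> \<noteq> \<eta>"
  shows "\<exists>(r :: nat \<Rightarrow> nat) T p. filterlim r at_top sequentially \<and>
    (\<forall>j. T j \<in> {a (r j)..b (r j)}) \<and> p \<in> \<Omega> \<and> (\<lambda>j. \<sigma> (r j) (T j)) \<longlonglongrightarrow> p"
proof (rule ccontr)
  assume contra: "\<not> ?thesis"
  note \<Omega> = assms(1) and \<sigma> = assms(4)
  have escape: "\<forall>\<^sub>F n in sequentially. \<forall>t\<in>{a n..b n}. \<sigma> n t \<notin> K" if K: "compact K" "K \<subseteq> \<Omega>" for K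
  proof (rule ccontr)
    assume "\<not> ?thesis"
    from not_eventually_sequentiallyD[OF this]
    obtain r :: "nat \<Rightarrow> nat" where r: "strict_mono r" "\<And>n. \<not> (\<forall>t\<in>{a (r n)..b (r n)}. \<sigma> (r n) t \<notin> K)"
      by blast
    then have "\<forall>n. \<exists>t. t \<in> {a (r n)..b (r n)} \<and> \<sigma> (r n) t \<in> K" by blast
    from choice[OF this]
    obtain t where t: "\<And>n. t n \<in> {a (r n)..b (r n)}" "\<And>n. \<sigma> (r n) (t n) \<in> K" by blast
    obtain p r' where p: "p \<in> K" "strict_mono r'" "((\<lambda>n. \<sigma> (r n) (t n)) \<circ> r') \<longlonglongrightarrow> p"
      using seq_compactE[OF compact_imp_seq_compact[OF K(1)], of "\<lambda>n. \<sigma> (r n) (t n)"] t(2) by blast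
    have "filterlim (r \<circ> r') at_top sequentially"
      by (rule filterlim_subseq[OF strict_mono_o[OF r(1) p(2)]])
    then have "\<exists>(r :: nat \<Rightarrow> nat) T p. filterlim r at_top sequentially \<and>
        (\<forall>j. T j \<in> {a (r j)..b (r j)}) \<and> p \<in> \<Omega> \<and> (\<lambda>j. \<sigma> (r j) (T j)) \<longlonglongrightarrow> p"
      using t(1) p K(2)
      by (intro exI[of _ "r \<circ> r'"] exI[of _ "t \<circ> r'"] exI[of _ p] conjI) (auto simp: o_def)
    with contra show False by contradiction
  qed
  obtain r :: "nat \<Rightarrow> nat" and p \<epsilon> T E where r: "strict_mono r" and \<epsilon>: "0 < \<epsilon>"
    and TE: "\<And>j. T j \<in> {a (r j)..b (r j)}" "\<And>j. E j \<in> {a (r j)..b (r j)}"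
    and lim: "(\<lambda>j. \<sigma> (r j) (T j)) \<longlonglongrightarrow> p" and far: "\<forall>\<^sub>F j in sequentially. \<epsilon> < dist p (\<sigma> (r j) (E j))"
    using end_separated_geodesics[OF \<Omega> assms(3) \<sigma> assms(5,6,7)] by blast
  let ?R = "norm p + \<epsilon>"
  obtain C \<beta> where C: "0 < C" "0 < \<beta>" and short: "\<And>\<sigma> a b h. a \<le> b \<Longrightarrow> kobayashi_geodesic \<Omega> {a..b} \<sigma> \<Longrightarrow>
      (\<And>t. t \<in> {a..b} \<Longrightarrow> norm (\<sigma> t) \<le> ?R \<and> infdist (\<sigma> t) (- \<Omega>) \<le> h) \<Longrightarrow>
      norm (\<sigma> a - \<sigma> b) \<le> C * h powr \<beta>"
    using kobayashi_geodesic_near_boundary[OF \<Omega> assms(2), of ?R] by metis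
  define h where "h = (\<epsilon> / (3 * C)) powr (1 / \<beta>)"
  have h: "0 < h" "C * h powr \<beta> = \<epsilon> / 3"
    using C \<epsilon> by (simp_all add: h_def powr_powr)
  define K where "K = {x. norm x \<le> ?R \<and> h \<le> infdist x (- \<Omega>)}"
  have "K = cball 0 ?R \<inter> {x. h \<le> infdist x (- \<Omega>)}" by (auto simp: K_def)
  moreover have "closed {x. h \<le> infdist x (- \<Omega>)}"
    by (intro closed_Collect_le continuous_intros)
  ultimately have "compact K" by (simp add: compact_Int_closed)
  moreover have "K \<subseteq> \<Omega>"
  proof
    fix x assume "x \<in> K"
    then have "infdist x (- \<Omega>) \<noteq> 0" using h(1) by (simp add: K_def)
    then show "x \<in> \<Omega>" by (cases "x \<in> \<Omega>") auto
  qed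
  ultimately have "\<forall>\<^sub>F n in sequentially. \<forall>t\<in>{a n..b n}. \<sigma> n t \<notin> K" by (rule escape)
  then have "\<forall>\<^sub>F j in sequentially. \<forall>t\<in>{a (r j)..b (r j)}. \<sigma> (r j) t \<notin> K"
    by (rule eventually_subseq[OF r])
  moreover have "\<forall>\<^sub>F j in sequentially. dist (\<sigma> (r j) (T j)) p < \<epsilon> / 3"
    by (rule tendstoD[OF lim]) (use \<epsilon> in simp)
  ultimately have "\<forall>\<^sub>F j in sequentially. False"
    using far
  proof eventually_elim
    case (elim j)
    let ?\<gamma> = "\<sigma> (r j)"
    have seg: "closed_segment (T j) (E j) \<subseteq> {a (r j)..b (r j)}"
      using TE[of j] by (intro closed_segment_subset) auto
    have geo: "kobayashi_geodesic \<Omega> I ?\<gamma>" if "I \<subseteq> {a (r j)..b (r j)}" "is_interval I" for I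
      using \<sigma>[of "r j"] that unfolding kobayashi_geodesic_def by blast
    have "continuous_on (closed_segment (T j) (E j)) (\<lambda>t. dist p (?\<gamma> t))"
      using continuous_on_subset[OF kobayashi_geodesic_continuous[OF \<Omega> \<sigma>] seg]
      by (intro continuous_intros)
    moreover have "dist p (?\<gamma> (T j)) < \<epsilon>" using elim(2) \<epsilon> by (simp add: dist_commute)
    ultimately obtain E' where E': "E' \<in> closed_segment (T j) (E j)" "dist p (?\<gamma> E') = \<epsilon>"
      "\<And>t. t \<in> closed_segment (T j) E' \<Longrightarrow> dist p (?\<gamma> t) \<le> \<epsilon>"
      using elim(3) by (rule first_exit_time) (rule that)
    define u where "u = min (T j) E'"
    define v where "v = max (T j) E'"
    have uv: "{u..v} = closed_segment (T j) E'" by (auto simp: u_def v_def closed_segment_eq_real_ivl)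
    have "closed_segment (T j) E' \<subseteq> closed_segment (T j) (E j)"
      using E'(1) by (simp add: subset_closed_segment)
    then have sub: "{u..v} \<subseteq> {a (r j)..b (r j)}" using seg uv by simp
    have "norm (?\<gamma> u - ?\<gamma> v) \<le> C * h powr \<beta>"
    proof (rule short)
      show "u \<le> v" by (simp add: u_def v_def)
      show "kobayashi_geodesic \<Omega> {u..v} ?\<gamma>" by (rule geo[OF sub]) (rule is_interval_cc)
      fix t assume t: "t \<in> {u..v}"
      then have "dist p (?\<gamma> t) \<le> \<epsilon>" using E'(3) uv by blast
      then have bound: "norm (?\<gamma> t) \<le> ?R"
        using norm_triangle_ineq2[of "?\<gamma> t" p] by (simp add: dist_norm norm_minus_commute)
      moreover have "?\<gamma> t \<notin> K" using elim(1) sub t by blast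
      ultimately show "norm (?\<gamma> t) \<le> ?R \<and> infdist (?\<gamma> t) (- \<Omega>) \<le> h" by (auto simp: K_def)
    qed
    moreover have "norm (?\<gamma> u - ?\<gamma> v) = dist (?\<gamma> (T j)) (?\<gamma> E')"
      by (cases "T j \<le> E'") (simp_all add: u_def v_def dist_norm norm_minus_commute)
    ultimately have "dist (?\<gamma> (T j)) (?\<gamma> E') \<le> \<epsilon> / 3" using h(2) by simp
    then show False
      using E'(2) elim(2) \<epsilon> dist_triangle[of p "?\<gamma> E'" "?\<gamma> (T j)"] by (simp add: dist_commute)
  qed
  then show False by simp
qed

end
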